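(* Let $t\geq 1$ be an integer. Every graph with thickness $t$ is: $\lceil\frac{9}{2}t\rceil$-choosable with defect $1$ and clustering $2$; $\lceil \frac{21}{5} t\rceil$-choosable with clustering $9$; and $4t$-choosable with clustering $228t-51$.
   Context: Graphs are finite and simple. The thickness of a graph $G$ is the minimum integer $t$ such that $G$ is the union of $t$ planar subgraphs. In a coloured graph the monochromatic subgraph is the spanning subgraph of edges whose endpoints have the same colour; its connected components are monochromatic components. A colouring has defect $d$ if the monochromatic subgraph has maximum degree at most $d$, and clustering $c$ if every monochromatic component has at most $c$ vertices. A $k$-list-assignment $L$ assigns to each vertex $v$ a set $L(v)$ of at least $k$ colours; an $L$-colouring colours each $v$ with a colour from $L(v)$. $G$ is $k$-choosable with defect $d$ and clustering $c$ if for every $k$-list-assignment $L$, $G$ has an $L$-colouring with defect $d$ and clustering $c$ (and similarly with only one of these conditions). *)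

theory Defs
  imports "HOL-Analysis.Analysis"
begin

definition simple_graph :: "'a set \<Rightarrow> 'a set set \<Rightarrow> bool" where
  "simple_graph V E \<longleftrightarrow> finite V \<and> (\<forall>e\<in>E. e \<subseteq> V \<and> card e = 2)"

(* A drawing of the graph in the plane (identified with the complex numbers): distinct vertices
   are distinct points, an edge is an arc joining its end-vertices that meets no other vertex,
   and two distinct edges meet only in the points of their common end-vertices. *)
definition plane_drawing ::
    "'a set \<Rightarrow> 'a set set \<Rightarrow> ('a \<Rightarrow> complex) \<Rightarrow> ('a set \<Rightarrow> real \<Rightarrow> complex) \<Rightarrow> bool" where
  "plane_drawing V E p \<gamma> \<longleftrightarrow>
     inj_on p V \<and>
     (\<forall>e\<in>E. arc (\<gamma> e) \<and> {pathstart (\<gamma> e), pathfinish (\<gamma> e)} = p ` e \<and>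
            path_image (\<gamma> e) \<inter> p ` V = p ` e) \<and>
     (\<forall>e\<in>E. \<forall>f\<in>E. e \<noteq> f \<longrightarrow> path_image (\<gamma> e) \<inter> path_image (\<gamma> f) = p ` (e \<inter> f))"

definition planar :: "'a set \<Rightarrow> 'a set set \<Rightarrow> bool" where
  "planar V E \<longleftrightarrow> (\<exists>p \<gamma>. plane_drawing V E p \<gamma>)"

definition union_of_planar_subgraphs :: "nat \<Rightarrow> 'a set \<Rightarrow> 'a set set \<Rightarrow> bool" where
  "union_of_planar_subgraphs t V E \<longleftrightarrow>
     (\<exists>W F. (\<forall>i<t. W i \<subseteq> V \<and> F i \<subseteq> E \<and> simple_graph (W i) (F i) \<and> planar (W i) (F i)) \<and>
            (\<Union>i<t. W i) = V \<and> (\<Union>i<t. F i) = E)"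

(* For a simple graph the minimum is attained: one planar subgraph for each vertex and
   each edge suffices. *)
definition thickness :: "'a set \<Rightarrow> 'a set set \<Rightarrow> nat" where
  "thickness V E = (LEAST t. union_of_planar_subgraphs t V E)"

definition degree :: "'a set set \<Rightarrow> 'a \<Rightarrow> nat" where
  "degree E v = card {e \<in> E. v \<in> e}"

definition component_of :: "'a set \<Rightarrow> 'a set set \<Rightarrow> 'a \<Rightarrow> 'a set" where
  "component_of V E v = {u \<in> V. (v, u) \<in> {(x, y). {x, y} \<in> E}\<^sup>*}"

definition graph_components :: "'a set \<Rightarrow> 'a set set \<Rightarrow> 'a set set" where
  "graph_components V E = component_of V E ` V"

definition mono_edges :: "'a set set \<Rightarrow> ('a \<Rightarrow> 'c) \<Rightarrow> 'a set set" where
  "mono_edges E \<phi> = {e \<in> E. \<forall>u\<in>e. \<forall>v\<in>e. \<phi> u = \<phi> v}"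

definition has_defect :: "'a set \<Rightarrow> 'a set set \<Rightarrow> ('a \<Rightarrow> 'c) \<Rightarrow> nat \<Rightarrow> bool" where
  "has_defect V E \<phi> d \<longleftrightarrow> (\<forall>v\<in>V. degree (mono_edges E \<phi>) v \<le> d)"

definition has_clustering :: "'a set \<Rightarrow> 'a set set \<Rightarrow> ('a \<Rightarrow> 'c) \<Rightarrow> nat \<Rightarrow> bool" where
  "has_clustering V E \<phi> c \<longleftrightarrow> (\<forall>C \<in> graph_components V (mono_edges E \<phi>). card C \<le> c)"

(* Lists may be infinite; since card is 0 on infinite sets, that case is listed separately. *)
definition list_assignment :: "'a set \<Rightarrow> nat \<Rightarrow> ('a \<Rightarrow> 'c set) \<Rightarrow> bool" where
  "list_assignment V k L \<longleftrightarrow> (\<forall>v\<in>V. infinite (L v) \<or> k \<le> card (L v))"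

definition list_colouring :: "'a set \<Rightarrow> ('a \<Rightarrow> 'c set) \<Rightarrow> ('a \<Rightarrow> 'c) \<Rightarrow> bool" where
  "list_colouring V L \<phi> \<longleftrightarrow> (\<forall>v\<in>V. \<phi> v \<in> L v)"

(* The first argument only fixes the type of colours; results are meant to be stated
   for an arbitrary type. *)
definition choosable_defect_clustering ::
    "'c itself \<Rightarrow> 'a set \<Rightarrow> 'a set set \<Rightarrow> nat \<Rightarrow> nat \<Rightarrow> nat \<Rightarrow> bool" where
  "choosable_defect_clustering _ V E k d c \<longleftrightarrow>
     (\<forall>L :: 'a \<Rightarrow> 'c set. list_assignment V k L \<longrightarrow>
        (\<exists>\<phi>. list_colouring V L \<phi> \<and> has_defect V E \<phi> d \<and> has_clustering V E \<phi> c))"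

definition choosable_clustering ::
    "'c itself \<Rightarrow> 'a set \<Rightarrow> 'a set set \<Rightarrow> nat \<Rightarrow> nat \<Rightarrow> bool" where
  "choosable_clustering _ V E k c \<longleftrightarrow>
     (\<forall>L :: 'a \<Rightarrow> 'c set. list_assignment V k L \<longrightarrow>
        (\<exists>\<phi>. list_colouring V L \<phi> \<and> has_clustering V E \<phi> c))"

end

theory Submission imports Defs begin

text \<open>
  A planar graph on \<open>n > 0\<close> vertices has fewer than \<open>3 n\<close> edges, so in a graph of thickness \<open>t\<close> every
  nonempty set \<open>S\<close> of vertices spans \<open>e(S) < 3 t |S|\<close> edges. This density condition alone gives
  clustering 2 (hence defect 1) from \<open>9 t / 2\<close> colours on, and clustering 3 already from \<open>4 t\<close>
  colours on; the last two claims are weaker.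

  Let \<open>c = r + 1\<close> be the clustering. A set \<open>X\<close> minimising
  \<open>c (\<Sum>v\<in>X. deg v) - r e(X) - c k |X|\<close> is coloured last: once the rest is coloured, the remaining
  lists on \<open>X\<close> satisfy \<open>(\<Sum>v\<in>S. deg\<^sub>X v) + r e(S) < c (\<Sum>v\<in>S. |L v|)\<close> for all nonempty \<open>S \<subseteq> X\<close>.
  In the remaining problem take a colouring with the fewest monochromatic edges. For \<open>r = 1\<close> it has
  monochromatic degrees at most 1. For \<open>r = 2\<close>, let \<open>S\<close> be the set of vertices whose deletion makes
  this minimum \<open>\<mu>\<close> as small as possible; if some minimum colouring has monochromatic degrees at most
  1, it will do, and otherwise \<open>\<mu>(X - v) + 2 \<le> \<mu>(X)\<close> for \<open>v \<in> S\<close>. Colour \<open>X - v\<close> inductively: every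
  colour occurs at least twice around \<open>v\<close>, and a colour \<open>a\<close> occurring exactly twice extends the
  colouring to a minimum one. Only a neighbour of colour \<open>a\<close> in \<open>S\<close> can then have
  monochromatic degree above 1, so if there is none the component of \<open>v\<close> has at most 3 vertices.
  Hence if there is no good colouring, then \<open>3 |L v| \<le> deg\<^sub>X v + deg\<^sub>S v\<close> for all \<open>v \<in> S\<close>, and
  summation contradicts the condition on the lists.

  For the bound on planar graphs the edges are drawn one by one. An edge closing a cycle increases
  the number of faces by the Jordan curve theorem, and any other edge decreases the number of components
  of the drawing. In the final drawing every face meets at least three edges, since two arcs sharing
  at most one point do not separate the plane, and every edge meets at most two faces, since an arc
  splits a face into at most two.
\<close>

section \<open>Colourings with few monochromatic edges\<close>

definition induced_edges :: "'a set set \<Rightarrow> 'a set \<Rightarrow> 'a set set" where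
  "induced_edges E X = {e \<in> E. e \<subseteq> X}"

definition nbrs :: "'a set set \<Rightarrow> 'a set \<Rightarrow> 'a \<Rightarrow> 'a set" where
  "nbrs E X v = {u \<in> X. {u, v} \<in> E}"

definition colour_nbrs :: "'a set set \<Rightarrow> 'a set \<Rightarrow> ('a \<Rightarrow> 'c) \<Rightarrow> 'a \<Rightarrow> 'c \<Rightarrow> 'a set" where
  "colour_nbrs E X \<phi> v c = {u \<in> nbrs E X v. \<phi> u = c}"

definition energy :: "'a set set \<Rightarrow> 'a set \<Rightarrow> ('a \<Rightarrow> 'c) \<Rightarrow> nat" where
  "energy E X \<phi> = card (mono_edges (induced_edges E X) \<phi>)"

definition clustered :: "'a set set \<Rightarrow> 'a set \<Rightarrow> nat \<Rightarrow> ('a \<Rightarrow> 'c) \<Rightarrow> bool" where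
  "clustered E X c \<phi> \<longleftrightarrow>
     (\<forall>v\<in>X. card (component_of X (mono_edges (induced_edges E X) \<phi>) v) \<le> c)"

definition pair_edges :: "'a set set \<Rightarrow> bool" where
  "pair_edges E \<longleftrightarrow> (\<forall>e\<in>E. card e = 2)"

lemma pair_edges_neq: "pair_edges E \<Longrightarrow> {u, v} \<in> E \<Longrightarrow> u \<noteq> v"
  unfolding pair_edges_def by force

lemma pair_edgesE:
  assumes "pair_edges E" "e \<in> E"
  obtains u v where "e = {u, v}" "u \<noteq> v"
  using assms unfolding pair_edges_def card_2_iff by blast

lemma finite_induced_edges [simp]: "finite X \<Longrightarrow> finite (induced_edges E X)"
  unfolding induced_edges_def by (rule finite_subset[of _ "Pow X"]) auto

lemma finite_nbrs [simp]: "finite X \<Longrightarrow> finite (nbrs E X v)"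
  unfolding nbrs_def by auto

lemma finite_colour_nbrs [simp]: "finite X \<Longrightarrow> finite (colour_nbrs E X \<phi> v c)"
  unfolding colour_nbrs_def by auto

lemma mono_edges_induced_iff:
  "{u, v} \<in> mono_edges (induced_edges E X) \<phi> \<longleftrightarrow> {u, v} \<in> E \<and> u \<in> X \<and> v \<in> X \<and> \<phi> u = \<phi> v"
  (is "?l = ?r")
proof
  show "?l \<Longrightarrow> ?r" unfolding mono_edges_def induced_edges_def by blast
  assume r: ?r
  have "\<phi> a = \<phi> v" if "a \<in> {u, v}" for a
    using r that by blast
  then have "\<And>a b. a \<in> {u, v} \<Longrightarrow> b \<in> {u, v} \<Longrightarrow> \<phi> a = \<phi> b"
    by metis
  moreover have "{u, v} \<in> E" "{u, v} \<subseteq> X" using r by blast+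
  ultimately show ?l unfolding mono_edges_def induced_edges_def by blast
qed

lemma energy_remove:
  assumes E: "pair_edges E" and "finite X" "v \<in> X"
  shows "energy E X \<phi> = energy E (X - {v}) \<phi> + card (colour_nbrs E X \<phi> v (\<phi> v))"
proof -
  let ?M = "\<lambda>Y. mono_edges (induced_edges E Y) \<phi>"
  let ?N = "(\<lambda>u. {u, v}) ` colour_nbrs E X \<phi> v (\<phi> v)"
  have "?M X = ?M (X - {v}) \<union> ?N"
  proof (rule set_eqI, rule iffI)
    fix e assume e: "e \<in> ?M X"
    show "e \<in> ?M (X - {v}) \<union> ?N"
    proof (cases "v \<in> e")
      case False
      then have "e \<in> ?M (X - {v})"
        using e unfolding mono_edges_def induced_edges_def by blast
      then show ?thesis ..
    next
      case True
      have "e \<in> E" using e unfolding mono_edges_def induced_edges_def by auto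
      then obtain a b where "e = {a, b}" "a \<noteq> b" using pair_edgesE[OF E] by metis
      with True obtain u where u: "e = {u, v}" by auto
      have "u \<in> X" "\<phi> u = \<phi> v" "{u, v} \<in> E"
        using e unfolding u mono_edges_induced_iff by auto
      then have "u \<in> colour_nbrs E X \<phi> v (\<phi> v)"
        by (simp add: colour_nbrs_def nbrs_def)
      then show ?thesis unfolding u by blast
    qed
  next
    fix e assume "e \<in> ?M (X - {v}) \<union> ?N"
    then show "e \<in> ?M X"
    proof
      assume "e \<in> ?M (X - {v})"
      then show ?thesis unfolding mono_edges_def induced_edges_def by blast
    next
      assume "e \<in> ?N"
      then obtain u where "e = {u, v}" "u \<in> X" "{u, v} \<in> E" "\<phi> u = \<phi> v"
        by (auto simp: colour_nbrs_def nbrs_def)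
      then show ?thesis
        using \<open>v \<in> X\<close> by (simp add: mono_edges_induced_iff)
    qed
  qed
  moreover have "?M (X - {v}) \<inter> ?N = {}"
    unfolding mono_edges_def induced_edges_def by auto
  moreover have "card ?N = card (colour_nbrs E X \<phi> v (\<phi> v))"
  proof (rule card_image, rule inj_onI)
    fix x y assume "x \<in> colour_nbrs E X \<phi> v (\<phi> v)" "{x, v} = {y, v}"
    then show "x = y"
      by (metis doubleton_eq_iff)
  qed
  moreover have "finite (?M (X - {v}))" "finite ?N"
    using \<open>finite X\<close> by (auto simp: mono_edges_def)
  ultimately show ?thesis
    unfolding energy_def by (simp only: card_Un_disjoint)
qed

lemma energy_cong:
  fixes \<phi> \<psi> :: "'a \<Rightarrow> 'c"
  assumes "\<And>x. x \<in> X \<Longrightarrow> \<phi> x = \<psi> x"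
  shows "energy E X \<phi> = energy E X \<psi>"
proof -
  have "e \<in> mono_edges (induced_edges E X) \<psi>"
    if e: "e \<in> mono_edges (induced_edges E X) \<phi>" and eq: "\<And>x. x \<in> X \<Longrightarrow> \<phi> x = \<psi> x"
    for e and \<phi> \<psi> :: "'a \<Rightarrow> 'c"
  proof -
    have "e \<in> E" "e \<subseteq> X" "\<And>u v. u \<in> e \<Longrightarrow> v \<in> e \<Longrightarrow> \<phi> u = \<phi> v"
      using e unfolding mono_edges_def induced_edges_def by blast+
    moreover have "\<psi> u = \<psi> v" if "u \<in> e" "v \<in> e" for u v
    proof -
      have "\<phi> u = \<psi> u" "\<phi> v = \<psi> v" using eq that \<open>e \<subseteq> X\<close> by blast+
      then show ?thesis using \<open>\<And>u v. u \<in> e \<Longrightarrow> v \<in> e \<Longrightarrow> \<phi> u = \<phi> v\<close>[OF that] by argo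
    qed
    ultimately show ?thesis unfolding mono_edges_def induced_edges_def by blast
  qed
  from this[of _ \<phi> \<psi>] this[of _ \<psi> \<phi>]
  have "mono_edges (induced_edges E X) \<phi> = mono_edges (induced_edges E X) \<psi>"
    using assms assms[symmetric] by (intro equalityI subsetI) blast+
  then show ?thesis unfolding energy_def by (rule arg_cong)
qed

lemma nbrs_insert_self:
  assumes "pair_edges E"
  shows "nbrs E (insert v X) v = nbrs E X v"
proof -
  have "{v, v} \<notin> E" using pair_edges_neq[OF assms] by blast
  then show ?thesis unfolding nbrs_def by auto
qed

lemma card_induced_insert:
  assumes "pair_edges E" "finite X" "v \<notin> X"
  shows "card (induced_edges E (insert v X)) = card (induced_edges E X) + card (nbrs E X v)"
proof -
  have "energy E Y (\<lambda>_. ()) = card (induced_edges E Y)" for Y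
    unfolding energy_def mono_edges_def by simp
  moreover have "colour_nbrs E (insert v X) (\<lambda>_. ()) v () = nbrs E X v"
    using nbrs_insert_self[OF assms(1)] unfolding colour_nbrs_def by auto
  ultimately show ?thesis
    using energy_remove[OF assms(1), of "insert v X" v "\<lambda>_. ()"] assms by simp
qed

lemma card_nbrs_Un:
  assumes "finite A" "finite B" "A \<inter> B = {}"
  shows "card (nbrs E (A \<union> B) v) = card (nbrs E A v) + card (nbrs E B v)"
proof -
  have "nbrs E (A \<union> B) v = nbrs E A v \<union> nbrs E B v" "nbrs E A v \<inter> nbrs E B v = {}"
    using assms unfolding nbrs_def by auto
  then show ?thesis using assms by (simp add: card_Un_disjoint)
qed

lemma card_induced_diff:
  assumes E: "pair_edges E" and X: "finite X" and "S \<subseteq> X"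
  shows "card (induced_edges E X) + card (induced_edges E S) =
         card (induced_edges E (X - S)) + (\<Sum>v\<in>S. card (nbrs E X v))"
proof -
  have "finite S" using assms finite_subset by auto
  then show ?thesis using \<open>S \<subseteq> X\<close>
  proof (induction S rule: finite_induct)
    case empty
    have "induced_edges E {} = {}"
      using E unfolding induced_edges_def pair_edges_def by auto
    then show ?case by simp
  next
    case (insert v S)
    define Y where "Y = X - insert v S"
    have Y: "X - S = insert v Y" "v \<notin> Y" "finite Y" "S \<inter> Y = {}"
      and Xeq: "insert v (S \<union> Y) = X"
      using insert.hyps(2) insert.prems X unfolding Y_def by blast+
    have "nbrs E X v = nbrs E (S \<union> Y) v"
      using nbrs_insert_self[OF E, of v "S \<union> Y"] unfolding Xeq .
    then have "card (nbrs E X v) = card (nbrs E S v) + card (nbrs E Y v)"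
      using card_nbrs_Un[OF insert.hyps(1) Y(3,4)] by simp
    moreover have "card (induced_edges E (X - S)) = card (induced_edges E Y) + card (nbrs E Y v)"
      unfolding Y(1) by (rule card_induced_insert[OF E Y(3,2)])
    moreover have "card (induced_edges E (insert v S)) = card (induced_edges E S) + card (nbrs E S v)"
      by (rule card_induced_insert[OF E insert.hyps])
    moreover have "(\<Sum>u\<in>insert v S. card (nbrs E X u)) = card (nbrs E X v) + (\<Sum>u\<in>S. card (nbrs E X u))"
      using insert.hyps by simp
    moreover have "S \<subseteq> X" using insert.prems by blast
    ultimately show ?case using insert.IH unfolding Y_def[symmetric] by linarith
  qed
qed

lemma sum_card_nbrs:
  assumes "pair_edges E" "finite S"
  shows "(\<Sum>v\<in>S. card (nbrs E S v)) = 2 * card (induced_edges E S)"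
proof -
  have "induced_edges E {} = {}"
    using assms unfolding induced_edges_def pair_edges_def by auto
  then show ?thesis using card_induced_diff[of E S S] assms by simp
qed

lemma component_of_subset:
  assumes "v \<in> C" "\<And>x y. x \<in> C \<Longrightarrow> {x, y} \<in> F \<Longrightarrow> y \<in> C"
  shows "component_of X F v \<subseteq> C"
proof -
  have "u \<in> C" if "(v, u) \<in> {(x, y). {x, y} \<in> F}\<^sup>*" for u
    using that by induction (use assms in auto)
  then show ?thesis unfolding component_of_def by auto
qed

lemma component_of_step:
  assumes "u \<in> component_of X F v" "{u, w} \<in> F" "w \<in> X"
  shows "w \<in> component_of X F v"
  using assms unfolding component_of_def by (auto intro: rtrancl_into_rtrancl)

lemma component_of_refl: "v \<in> X \<Longrightarrow> v \<in> component_of X F v"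
  unfolding component_of_def by auto

lemma clustered_if_matching:
  assumes E: "pair_edges E" and "finite X"
    and deg: "\<And>v. v \<in> X \<Longrightarrow> card (colour_nbrs E X \<phi> v (\<phi> v)) \<le> 1"
  shows "clustered E X 2 \<phi>"
  unfolding clustered_def
proof
  fix v assume v: "v \<in> X"
  let ?N = "\<lambda>v. colour_nbrs E X \<phi> v (\<phi> v)"
  have "component_of X (mono_edges (induced_edges E X) \<phi>) v \<subseteq> insert v (?N v)"
  proof (rule component_of_subset)
    fix x y assume x: "x \<in> insert v (?N v)"
      and "{x, y} \<in> mono_edges (induced_edges E X) \<phi>"
    then have xy: "{x, y} \<in> E" "x \<in> X" "y \<in> X" "\<phi> x = \<phi> y"
      unfolding mono_edges_induced_iff by blast+
    show "y \<in> insert v (?N v)"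
    proof (cases "x = v")
      case True
      then show ?thesis using xy by (auto simp: colour_nbrs_def nbrs_def insert_commute)
    next
      case False
      then have "{v, y} \<subseteq> ?N x"
        using x xy v by (auto simp: colour_nbrs_def nbrs_def insert_commute)
      then have "card {v, y} \<le> 1"
        using deg[OF \<open>x \<in> X\<close>] \<open>finite X\<close> by (meson card_mono finite_colour_nbrs order_trans)
      then show ?thesis by (cases "v = y") auto
    qed
  qed auto
  then have "card (component_of X (mono_edges (induced_edges E X) \<phi>) v) \<le> card (insert v (?N v))"
    using \<open>finite X\<close> by (simp add: card_mono)
  also have "\<dots> \<le> 2"
    using deg[OF v] card_insert_le_m1[of 2 "?N v" v] by auto
  finally show "card (component_of X (mono_edges (induced_edges E X) \<phi>) v) \<le> 2" .
qed

lemma sum_colour_nbrs_le: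
  assumes "finite X" "finite C"
  shows "(\<Sum>c\<in>C. card (colour_nbrs E X \<phi> v c)) \<le> card (nbrs E X v)"
proof -
  have "(\<Sum>c\<in>C. card (colour_nbrs E X \<phi> v c)) = card (\<Union>c\<in>C. colour_nbrs E X \<phi> v c)"
    using assms by (subst card_UN_disjoint) (auto simp: colour_nbrs_def)
  also have "\<dots> \<le> card (nbrs E X v)"
    using assms by (intro card_mono) (auto simp: colour_nbrs_def)
  finally show ?thesis .
qed

definition min_energy :: "'a set set \<Rightarrow> ('a \<Rightarrow> 'c set) \<Rightarrow> 'a set \<Rightarrow> nat" where
  "min_energy E L X = (LEAST n. \<exists>\<phi>. list_colouring X L \<phi> \<and> energy E X \<phi> = n)"

lemma min_energy_le: "list_colouring X L \<phi> \<Longrightarrow> min_energy E L X \<le> energy E X \<phi>"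
  unfolding min_energy_def by (rule Least_le) auto

lemma min_energy_attained:
  assumes "\<And>v. v \<in> X \<Longrightarrow> L v \<noteq> {}"
  obtains \<phi> where "list_colouring X L \<phi>" "energy E X \<phi> = min_energy E L X"
proof -
  have "list_colouring X L (\<lambda>v. SOME c. c \<in> L v)"
    using assms unfolding list_colouring_def by (simp add: some_in_eq)
  then have "\<exists>n \<phi>. list_colouring X L \<phi> \<and> energy E X \<phi> = n" by blast
  then show ?thesis
    using LeastI_ex[of "\<lambda>n. \<exists>\<phi>. list_colouring X L \<phi> \<and> energy E X \<phi> = n"] that
    unfolding min_energy_def by blast
qed

lemma colour_nbrs_upd [simp]:
  assumes "pair_edges E"
  shows "colour_nbrs E X (\<phi>(v := c)) v = colour_nbrs E X \<phi> v"
proof -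
  have "{v, v} \<notin> E" using pair_edges_neq[OF assms] by blast
  then show ?thesis unfolding colour_nbrs_def nbrs_def by (intro ext) auto
qed

lemma energy_upd:
  assumes "pair_edges E" "finite X" "v \<in> X"
  shows "energy E X (\<phi>(v := c)) = energy E (X - {v}) \<phi> + card (colour_nbrs E X \<phi> v c)"
  using energy_remove[OF assms, of "\<phi>(v := c)"] energy_cong[of "X - {v}" "\<phi>(v := c)" \<phi> E] assms(1)
  by simp

lemma colouring_clustering2:
  assumes E: "pair_edges E" and X: "finite X"
    and L: "\<And>v. v \<in> X \<Longrightarrow> finite (L v)"
    and dens: "\<And>v. v \<in> X \<Longrightarrow> card (nbrs E X v) < 2 * card (L v)"
  shows "\<exists>\<phi>. list_colouring X L \<phi> \<and> clustered E X 2 \<phi>"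
proof -
  have "L v \<noteq> {}" if "v \<in> X" for v using dens[OF that] by auto
  then obtain \<phi> where \<phi>: "list_colouring X L \<phi>" "energy E X \<phi> = min_energy E L X"
    using min_energy_attained by metis
  have "card (colour_nbrs E X \<phi> v (\<phi> v)) \<le> 1" if v: "v \<in> X" for v
  proof (rule ccontr)
    assume not: "\<not> ?thesis"
    have "2 \<le> card (colour_nbrs E X \<phi> v c)" if c: "c \<in> L v" for c
    proof -
      have "list_colouring X L (\<phi>(v := c))"
        using \<phi>(1) c unfolding list_colouring_def by auto
      from min_energy_le[OF this, of E] show ?thesis
        using \<phi>(2) energy_upd[OF E X v, of \<phi> c] energy_remove[OF E X v, of \<phi>] not by linarith
    qed
    then have "2 * card (L v) \<le> (\<Sum>c\<in>L v. card (colour_nbrs E X \<phi> v c))"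
      using sum_mono[of "L v" "\<lambda>_. 2" "\<lambda>c. card (colour_nbrs E X \<phi> v c)"] by simp
    then show False
      using sum_colour_nbrs_le[OF X L[OF v], of E \<phi> v] dens[OF v] by simp
  qed
  then show ?thesis using clustered_if_matching[OF E X] \<phi>(1) by blast
qed

lemma component_of_upd_subset:
  assumes uT: "u \<notin> T" and vT: "v \<in> T" and u: "u \<in> X"
    and T: "\<And>x y. x \<in> T \<Longrightarrow> {x, y} \<in> mono_edges (induced_edges E X) (\<psi>(v := c)) \<Longrightarrow> y \<in> T"
  shows "component_of X (mono_edges (induced_edges E X) (\<psi>(v := c))) u
    \<subseteq> component_of (X - {v}) (mono_edges (induced_edges E (X - {v})) \<psi>) u"
proof -
  let ?F' = "mono_edges (induced_edges E (X - {v})) \<psi>"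
  let ?\<phi> = "\<psi>(v := c)"
  let ?F = "mono_edges (induced_edges E X) ?\<phi>"
  let ?C = "component_of (X - {v}) ?F' u"
  have u': "u \<in> X - {v}" using uT u vT by auto
  have "component_of X ?F u \<subseteq> ?C - T"
  proof (rule component_of_subset)
    show "u \<in> ?C - T" using uT component_of_refl[OF u'] by auto
  next
    fix x y assume x: "x \<in> ?C - T" and e: "{x, y} \<in> ?F"
    have "{y, x} \<in> ?F" using e insert_commute[of x y "{}"] by metis
    then have yT: "y \<notin> T" using T[of y x] x by blast
    then have "y \<noteq> v" using vT by blast
    have xv: "x \<in> ?C" "x \<noteq> v" using x vT by blast+
    have xy: "{x, y} \<in> E" "x \<in> X" "y \<in> X" and eq: "?\<phi> x = ?\<phi> y"
        using e unfolding mono_edges_induced_iff by blast+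
    have "\<psi> x = \<psi> y" using eq xv(2) \<open>y \<noteq> v\<close> by simp
    then have "{x, y} \<in> ?F'" "y \<in> X - {v}"
      unfolding mono_edges_induced_iff using xy xv(2) \<open>y \<noteq> v\<close> by blast+
    then show "y \<in> ?C - T"
        using xv(1) yT component_of_step[of x "X - {v}" ?F' u y] by blast
  qed
  then show ?thesis by blast
qed

lemma clustered_upd:
  assumes E: "pair_edges E" and X: "finite X" and v: "v \<in> X"
    and cl: "clustered E (X - {v}) 3 \<psi>"
    and two: "card (colour_nbrs E X \<psi> v c) \<le> 2"
    and deg: "\<And>x. x \<in> colour_nbrs E X \<psi> v c \<Longrightarrow>
                card (colour_nbrs E X (\<psi>(v := c)) x c) \<le> 1"
  shows "clustered E X 3 (\<psi>(v := c))"
  unfolding clustered_def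
proof
  fix u assume u: "u \<in> X"
  let ?\<phi> = "\<psi>(v := c)"
  let ?N = "colour_nbrs E X \<psi> v c"
  let ?F = "mono_edges (induced_edges E X) ?\<phi>"
  let ?T = "insert v ?N"
  have T: "y \<in> ?T" if x: "x \<in> ?T" and e: "{x, y} \<in> ?F" for x y
  proof -
    have xy: "{x, y} \<in> E" "x \<in> X" "y \<in> X" and eq: "?\<phi> x = ?\<phi> y"
      using e unfolding mono_edges_induced_iff by blast+
    have "x \<noteq> y" using pair_edges_neq[OF E xy(1)] .
    show ?thesis
    proof (cases "x = v")
      case True
      then have "\<psi> y = c" using eq \<open>x \<noteq> y\<close> by simp
      then show ?thesis
        using True xy by (simp add: colour_nbrs_def nbrs_def insert_commute)
    next
      case False
      then have xN: "x \<in> ?N" and "\<psi> x = c" "{x, v} \<in> E"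
        using x by (auto simp: colour_nbrs_def nbrs_def)
      then have "?\<phi> y = c" using eq False by simp
      then have "{v, y} \<subseteq> colour_nbrs E X ?\<phi> x c"
        using \<open>{x, v} \<in> E\<close> xy v by (simp add: colour_nbrs_def nbrs_def insert_commute)
      then have "card {v, y} \<le> 1"
        using deg[OF xN] X by (meson card_mono finite_colour_nbrs order_trans)
      then show ?thesis by (cases "v = y") auto
    qed
  qed
  have cardT: "card ?T \<le> 3"
    using two X by (simp add: card_insert_if)
  show "card (component_of X ?F u) \<le> 3"
  proof (cases "u \<in> ?T")
    case True
    then have "component_of X ?F u \<subseteq> ?T" by (rule component_of_subset) (rule T)
    then have "card (component_of X ?F u) \<le> card ?T"
      using X by (intro card_mono) auto
    with cardT show ?thesis by simp
  next
    case False
    let ?F' = "mono_edges (induced_edges E (X - {v})) \<psi>"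
    let ?C = "component_of (X - {v}) ?F' u"
    have u': "u \<in> X - {v}" using False u by blast
    have "component_of X ?F u \<subseteq> ?C"
      by (rule component_of_upd_subset[OF False _ u T]) auto
    moreover have "finite ?C" using X unfolding component_of_def by auto
    ultimately have "card (component_of X ?F u) \<le> card ?C" by (rule card_mono[rotated])
    also have "\<dots> \<le> 3" using cl u' unfolding clustered_def by blast
    finally show ?thesis .
  qed
qed

lemma colouring_clustering3:
  assumes E: "pair_edges E" and X: "finite X"
    and L: "\<And>v. v \<in> X \<Longrightarrow> finite (L v)"
    and dens: "\<And>S. S \<subseteq> X \<Longrightarrow> S \<noteq> {} \<Longrightarrow>
      (\<Sum>v\<in>S. card (nbrs E X v)) + 2 * card (induced_edges E S) < 3 * (\<Sum>v\<in>S. card (L v))"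
  shows "\<exists>\<phi>. list_colouring X L \<phi> \<and> energy E X \<phi> = min_energy E L X \<and> clustered E X 3 \<phi>"
  using X L dens
proof (induction X rule: finite_psubset_induct)
  case (psubset X)
  note X = \<open>finite X\<close>
  have ne: "L v \<noteq> {}" if "v \<in> X" for v
    using psubset.prems(2)[of "{v}"] that by auto
  let ?m = "min_energy E L"
  show ?case
  proof (rule ccontr)
    assume no: "\<not> ?case"
    have IH: "\<exists>\<psi>. list_colouring (X - {v}) L \<psi> \<and> energy E (X - {v}) \<psi> = ?m (X - {v}) \<and>
        clustered E (X - {v}) 3 \<psi>" if v: "v \<in> X" for v
    proof (rule psubset.IH)
      fix S assume S: "S \<subseteq> X - {v}" "S \<noteq> {}"
      have "(\<Sum>u\<in>S. card (nbrs E (X - {v}) u)) \<le> (\<Sum>u\<in>S. card (nbrs E X u))"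
        using X by (intro sum_mono card_mono) (auto simp: nbrs_def)
      then show "(\<Sum>u\<in>S. card (nbrs E (X - {v}) u)) + 2 * card (induced_edges E S)
          < 3 * (\<Sum>u\<in>S. card (L u))"
        using psubset.prems(2)[of S] S by fastforce
    qed (use v psubset.prems in auto)
    have Xne: "X \<noteq> {}"
    proof
      assume "X = {}"
      moreover obtain \<phi> where "list_colouring X L \<phi>" "energy E X \<phi> = ?m X"
        using min_energy_attained ne by metis
      ultimately show False using no by (auto simp: clustered_def)
    qed
    define m where "m = Min ((\<lambda>v. ?m (X - {v})) ` X)"
    define S where "S = {v \<in> X. ?m (X - {v}) = m}"
    have m_le: "m \<le> ?m (X - {v})" if "v \<in> X" for v
      using that X unfolding m_def by auto
    have "m \<in> (\<lambda>v. ?m (X - {v})) ` X"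
      unfolding m_def using X Xne by (intro Min_in) auto
    then have Sne: "S \<noteq> {}" unfolding S_def by auto
    have SX: "S \<subseteq> X" unfolding S_def by auto
    then have Sfin: "finite S" using X finite_subset by auto
    have sub: "list_colouring (X - {v}) L \<phi>" if "list_colouring X L \<phi>" for v \<phi>
      using that unfolding list_colouring_def by auto
    have low: "m + card (colour_nbrs E X \<phi> v (\<phi> v)) \<le> energy E X \<phi>"
      if "list_colouring X L \<phi>" "v \<in> X" for \<phi> v
      using energy_remove[OF E X that(2), of \<phi>] min_energy_le[OF sub[OF that(1)], of E v]
        m_le[OF that(2)] by linarith
    have m2: "m + 2 \<le> ?m X"
    proof (rule ccontr)
      assume lt: "\<not> m + 2 \<le> ?m X"
      obtain \<phi> where \<phi>: "list_colouring X L \<phi>" "energy E X \<phi> = ?m X"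
        using min_energy_attained ne by metis
      have "card (colour_nbrs E X \<phi> v (\<phi> v)) \<le> 1" if "v \<in> X" for v
        using low[OF \<phi>(1) that] \<phi>(2) lt by linarith
      then have "clustered E X 2 \<phi>" by (rule clustered_if_matching[OF E X])
      then have "clustered E X 3 \<phi>" unfolding clustered_def by fastforce
      with no \<phi> show False by blast
    qed
    have key: "3 * card (L v) \<le> card (nbrs E X v) + card (nbrs E S v)" if v: "v \<in> S" for v
    proof -
      have vX: "v \<in> X" using v SX by auto
      obtain \<psi> where \<psi>: "list_colouring (X - {v}) L \<psi>" "energy E (X - {v}) \<psi> = m"
        "clustered E (X - {v}) 3 \<psi>"
        using IH[OF vX] v unfolding S_def by auto
      let ?n = "\<lambda>c. card (colour_nbrs E X \<psi> v c)"
      define A where "A = {c \<in> L v. ?n c = 2}"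
      have finL: "finite (L v)" using psubset.prems(1) vX by auto
      have lc: "list_colouring X L (\<psi>(v := c))" if "c \<in> L v" for c
        using \<psi>(1) that unfolding list_colouring_def by auto
      have en: "energy E X (\<psi>(v := c)) = m + ?n c" for c
        using energy_upd[OF E X vX, of \<psi> c] \<psi>(2) by simp
      have n2: "2 \<le> ?n c" if "c \<in> L v" for c
        using min_energy_le[OF lc[OF that], of E] en[of c] m2 by linarith
      have ex: "\<exists>x\<in>S. {x, v} \<in> E \<and> \<psi> x = c" if c: "c \<in> A" for c
      proof (rule ccontr)
        assume none: "\<not> ?thesis"
        have cL: "c \<in> L v" "?n c = 2" using c unfolding A_def by auto
        have opt: "energy E X (\<psi>(v := c)) = ?m X"
          using min_energy_le[OF lc[OF cL(1)], of E] en[of c] m2 cL(2) by linarith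
        have "clustered E X 3 (\<psi>(v := c))"
        proof (rule clustered_upd[OF E X vX \<psi>(3)])
          fix x assume x: "x \<in> colour_nbrs E X \<psi> v c"
          have xX: "x \<in> X" "x \<noteq> v" "\<psi> x = c" "{x, v} \<in> E"
            using x pair_edges_neq[OF E] unfolding colour_nbrs_def nbrs_def by auto
          then have "x \<notin> S" using none by auto
          then have "m + 1 \<le> ?m (X - {x})"
            using m_le[OF xX(1)] xX(1) unfolding S_def by fastforce
          also have "\<dots> \<le> energy E (X - {x}) (\<psi>(v := c))"
            by (rule min_energy_le[OF sub[OF lc[OF cL(1)]]])
          finally show "card (colour_nbrs E X (\<psi>(v := c)) x c) \<le> 1"
            using energy_remove[OF E X xX(1), of "\<psi>(v := c)"] en[of c] cL(2) xX(2,3) by simp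
        qed (use cL in simp)
        with no lc[OF cL(1)] opt show False by blast
      qed
      have "card A \<le> card (\<psi> ` nbrs E S v)"
        using Sfin ex by (intro card_mono) (force simp: nbrs_def)+
      also have "\<dots> \<le> card (nbrs E S v)" using Sfin by (simp add: card_image_le)
      finally have cA: "card A \<le> card (nbrs E S v)" .
      have "3 * card (L v) = (\<Sum>c\<in>L v. 3)" by simp
      also have "\<dots> \<le> (\<Sum>c\<in>L v. ?n c + (if c \<in> A then 1 else 0))"
      proof (rule sum_mono)
        fix c assume c: "c \<in> L v"
        show "3 \<le> ?n c + (if c \<in> A then 1 else 0)"
          using n2[OF c] c unfolding A_def by auto
      qed
      also have "\<dots> = (\<Sum>c\<in>L v. ?n c) + card A"
      proof -
        have "L v \<inter> A = A" unfolding A_def by auto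
        then show ?thesis using finL by (simp add: sum.distrib flip: sum.inter_restrict)
      qed
      also have "\<dots> \<le> card (nbrs E X v) + card (nbrs E S v)"
        using sum_colour_nbrs_le[OF X finL, of E \<psi> v] cA by linarith
      finally show ?thesis .
    qed
    have "3 * (\<Sum>v\<in>S. card (L v)) \<le> (\<Sum>v\<in>S. card (nbrs E X v) + card (nbrs E S v))"
      unfolding sum_distrib_left using key by (rule sum_mono)
    also have "\<dots> = (\<Sum>v\<in>S. card (nbrs E X v)) + 2 * card (induced_edges E S)"
      by (simp add: sum.distrib sum_card_nbrs[OF E Sfin])
    finally show False using psubset.prems(2)[OF SX Sne] by simp
  qed
qed

section \<open>Peeling\<close>

lemma peeling_minimiser:
  assumes E: "pair_edges E" and V: "finite V"
    and sparse: "(r + 2) * card (induced_edges E V) < Suc r * k * card V"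
  obtains X where "X \<subseteq> V" "X \<noteq> {}"
    "\<And>S. S \<subseteq> X \<Longrightarrow> S \<noteq> {} \<Longrightarrow>
      Suc r * (\<Sum>v\<in>S. card (nbrs E V v)) + r * card (induced_edges E S)
        < Suc r * k * card S + r * (\<Sum>v\<in>S. card (nbrs E X v))"
proof -
  define \<Psi> where "\<Psi> X = int (Suc r * (\<Sum>v\<in>X. card (nbrs E V v))) -
      int (r * card (induced_edges E X)) - int (Suc r * k * card X)" for X
  \<comment> \<open>Minimising \<open>h\<close> minimises \<open>\<Psi>\<close> first and the cardinality second.\<close>
  define h where "h X = \<Psi> X * (int (card V) + 1) + int (card X)" for X
  have "finite (Pow V)" "Pow V \<noteq> {}" using V by auto
  then obtain X where X: "X \<in> Pow V" and least: "\<And>Y. Y \<in> Pow V \<Longrightarrow> h X \<le> h Y"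
    using arg_min_least[of "Pow V" _ h] arg_min_if_finite(1)[of "Pow V" h] by blast
  have finX: "finite X" using X V finite_subset by auto
  have "induced_edges E {} = {}"
    using E unfolding induced_edges_def pair_edges_def by auto
  then have h0: "h {} = 0" unfolding h_def \<Psi>_def by simp
  have "\<Psi> V = int ((r + 2) * card (induced_edges E V)) - int (Suc r * k * card V)"
    unfolding \<Psi>_def sum_card_nbrs[OF E V] by (simp add: algebra_simps)
  then have "\<Psi> V \<le> -1" using sparse by linarith
  then have "\<Psi> V * (int (card V) + 1) \<le> -1 * (int (card V) + 1)"
    by (rule mult_right_mono) simp
  then have "h V < 0" unfolding h_def by simp
  then have Xne: "X \<noteq> {}" using least[of V] h0 by auto
  show ?thesis
  proof (rule that[OF _ Xne])
    show "X \<subseteq> V" using X by auto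
    fix S assume S: "S \<subseteq> X" "S \<noteq> {}"
    have finS: "finite S" using S finX finite_subset by auto
    have cS: "card (X - S) < card X"
      using S finX by (intro psubset_card_mono) auto
    have lt: "\<Psi> X < \<Psi> (X - S)"
    proof (rule ccontr)
      assume "\<not> ?thesis"
      then have "\<Psi> (X - S) * (int (card V) + 1) \<le> \<Psi> X * (int (card V) + 1)"
        by (intro mult_right_mono) auto
      then have "h (X - S) < h X" using cS unfolding h_def by linarith
      moreover have "h X \<le> h (X - S)" using X by (intro least) auto
      ultimately show False by simp
    qed
    define a where "a = (\<Sum>v\<in>S. card (nbrs E V v))"
    define b where "b = (\<Sum>v\<in>X - S. card (nbrs E V v))"
    define d where "d = (\<Sum>v\<in>S. card (nbrs E X v))"
    define eX eS eR where "eX = card (induced_edges E X)" and "eS = card (induced_edges E S)"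
      and "eR = card (induced_edges E (X - S))"
    have "(\<Sum>v\<in>X. card (nbrs E V v)) = a + b"
      unfolding a_def b_def using sum.subset_diff[OF S(1) finX, of "\<lambda>v. card (nbrs E V v)"] by simp
    moreover have "card X = card S + card (X - S)"
      using card_Diff_subset[OF finS S(1)] card_mono[OF finX S(1)] by simp
    moreover have "eX + eS = eR + d"
      unfolding eX_def eS_def eR_def d_def by (rule card_induced_diff[OF E finX S(1)])
    then have "int r * (int eX + int eS) = int r * (int eR + int d)"
      by (simp flip: of_nat_add)
    then have "int r * int eX = int r * int eR + int r * int d - int r * int eS"
      by (simp add: algebra_simps)
    ultimately have "int (Suc r * a + r * eS) < int (Suc r * k * card S + r * d)"
      using lt unfolding \<Psi>_def eX_def[symmetric] eR_def[symmetric] b_def[symmetric]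
      by (simp add: algebra_simps)
    then show "Suc r * (\<Sum>v\<in>S. card (nbrs E V v)) + r * card (induced_edges E S)
        < Suc r * k * card S + r * (\<Sum>v\<in>S. card (nbrs E X v))"
      unfolding a_def d_def eS_def by linarith
  qed
qed

lemma component_of_induced_subset:
  assumes "v \<in> X" and eq: "\<And>x. x \<in> X \<Longrightarrow> \<phi> x = \<psi> x"
    and no: "\<And>x y. x \<in> X \<Longrightarrow> y \<in> V - X \<Longrightarrow> {x, y} \<in> E \<Longrightarrow> \<phi> x \<noteq> \<phi> y"
  shows "component_of V (mono_edges (induced_edges E V) \<phi>) v
    \<subseteq> component_of X (mono_edges (induced_edges E X) \<psi>) v"
proof (rule component_of_subset)
  show "v \<in> component_of X (mono_edges (induced_edges E X) \<psi>) v"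
    using component_of_refl assms(1) .
next
  fix x y assume x: "x \<in> component_of X (mono_edges (induced_edges E X) \<psi>) v"
    and e: "{x, y} \<in> mono_edges (induced_edges E V) \<phi>"
  have xX: "x \<in> X" using x unfolding component_of_def by blast
  have xy: "{x, y} \<in> E" "y \<in> V" "\<phi> x = \<phi> y"
    using e unfolding mono_edges_induced_iff by blast+
  then have yX: "y \<in> X" using no[OF xX] by blast
  have "\<psi> x = \<psi> y" using eq[OF xX] eq[OF yX] xy(3) by metis
  then have "{x, y} \<in> mono_edges (induced_edges E X) \<psi>"
    unfolding mono_edges_induced_iff using xX yX xy(1) by blast
  then show "y \<in> component_of X (mono_edges (induced_edges E X) \<psi>) v"
    using component_of_step[OF x _ yX] by blast
qed

lemma clustered_combine:
  assumes V: "finite V" and X: "X \<subseteq> V"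
    and cX: "clustered E X c \<psi>" and cR: "clustered E (V - X) c \<rho>"
    and no: "\<And>x y. x \<in> X \<Longrightarrow> y \<in> V - X \<Longrightarrow> {x, y} \<in> E \<Longrightarrow> \<psi> x \<noteq> \<rho> y"
  shows "clustered E V c (\<lambda>v. if v \<in> X then \<psi> v else \<rho> v)" (is "clustered E V c ?\<phi>")
  unfolding clustered_def
proof
  fix v assume v: "v \<in> V"
  have fin: "finite (component_of Y F u)" if "Y \<subseteq> V" for Y F u
    using that V finite_subset[of _ V] unfolding component_of_def by auto
  let ?K = "component_of V (mono_edges (induced_edges E V) ?\<phi>) v"
  show "card ?K \<le> c"
  proof (cases "v \<in> X")
    case True
    have "?K \<subseteq> component_of X (mono_edges (induced_edges E X) \<psi>) v"
      by (rule component_of_induced_subset[OF True]) (simp_all add: no)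
    then have "card ?K \<le> card (component_of X (mono_edges (induced_edges E X) \<psi>) v)"
      by (intro card_mono fin[OF X])
    then show ?thesis using cX True unfolding clustered_def by (meson order_trans)
  next
    case False
    then have vR: "v \<in> V - X" using v by blast
    have "?K \<subseteq> component_of (V - X) (mono_edges (induced_edges E (V - X)) \<rho>) v"
    proof (rule component_of_induced_subset[OF vR])
      fix x y assume "x \<in> V - X" "y \<in> V - (V - X)" "{x, y} \<in> E"
      moreover from this have "{y, x} \<in> E" by (metis insert_commute)
      ultimately show "?\<phi> x \<noteq> ?\<phi> y" using no[of y x] by auto
    qed simp
    then have "card ?K \<le> card (component_of (V - X) (mono_edges (induced_edges E (V - X)) \<rho>) v)"
      by (intro card_mono fin) auto
    then show ?thesis using cR vR unfolding clustered_def by (meson order_trans)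
  qed
qed

lemma colouring_by_peeling:
  fixes L :: "'a \<Rightarrow> 'c set"
  assumes E: "pair_edges E"
    and extend: "\<And>X (L :: 'a \<Rightarrow> 'c set). \<lbrakk>finite X; \<And>v. v \<in> X \<Longrightarrow> finite (L v);
        \<And>S. S \<subseteq> X \<Longrightarrow> S \<noteq> {} \<Longrightarrow>
          (\<Sum>v\<in>S. card (nbrs E X v)) + r * card (induced_edges E S) < Suc r * (\<Sum>v\<in>S. card (L v))\<rbrakk>
        \<Longrightarrow> \<exists>\<phi>. list_colouring X L \<phi> \<and> clustered E X c \<phi>"
    and V: "finite V"
    and sparse: "\<And>S. S \<subseteq> V \<Longrightarrow> S \<noteq> {} \<Longrightarrow> (r + 2) * card (induced_edges E S) < Suc r * k * card S"
    and L: "\<And>v. v \<in> V \<Longrightarrow> finite (L v) \<and> k \<le> card (L v)"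
  shows "\<exists>\<phi>. list_colouring V L \<phi> \<and> clustered E V c \<phi>"
  using V sparse L
proof (induction V rule: finite_psubset_induct)
  case (psubset V)
  show ?case
  proof (cases "V = {}")
    case True
    then show ?thesis unfolding list_colouring_def clustered_def by simp
  next
    case False
    then have "(r + 2) * card (induced_edges E V) < Suc r * k * card V"
      using psubset.prems(1) by blast
    then obtain X where X: "X \<subseteq> V" "X \<noteq> {}"
      and dens: "\<And>S. S \<subseteq> X \<Longrightarrow> S \<noteq> {} \<Longrightarrow>
        Suc r * (\<Sum>v\<in>S. card (nbrs E V v)) + r * card (induced_edges E S)
          < Suc r * k * card S + r * (\<Sum>v\<in>S. card (nbrs E X v))"
      using peeling_minimiser[OF E \<open>finite V\<close>] by metis
    have finX: "finite X" using X(1) \<open>finite V\<close> finite_subset by blast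
    have "\<exists>\<phi>. list_colouring (V - X) L \<phi> \<and> clustered E (V - X) c \<phi>"
    proof (rule psubset.IH)
      show "V - X \<subset> V" using X by blast
    qed (use psubset.prems in blast)+
    then obtain \<rho> where \<rho>: "list_colouring (V - X) L \<rho>" "clustered E (V - X) c \<rho>"
      by blast
    define L' where "L' v = L v - \<rho> ` nbrs E (V - X) v" for v
    have finV: "finite (V - X)" using \<open>finite V\<close> by simp
    have k: "k \<le> card (L' v) + card (nbrs E (V - X) v)" if "v \<in> X" for v
    proof -
      have "k \<le> card (L v)" using psubset.prems(2) that X(1) by blast
      also have "\<dots> \<le> card (L' v) + card (\<rho> ` nbrs E (V - X) v)"
        unfolding L'_def using diff_card_le_card_Diff[of "\<rho> ` nbrs E (V - X) v" "L v"] finV by simp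
      also have "\<dots> \<le> card (L' v) + card (nbrs E (V - X) v)"
        using card_image_le[of "nbrs E (V - X) v" \<rho>] finV by simp
      finally show ?thesis .
    qed
    have "\<exists>\<phi>. list_colouring X L' \<phi> \<and> clustered E X c \<phi>"
    proof (rule extend[OF finX])
      show "finite (L' v)" if "v \<in> X" for v
        using psubset.prems(2) that X(1) unfolding L'_def by blast
      fix S assume S: "S \<subseteq> X" "S \<noteq> {}"
      define dX dR l where "dX = (\<Sum>v\<in>S. card (nbrs E X v))"
        and "dR = (\<Sum>v\<in>S. card (nbrs E (V - X) v))" and "l = (\<Sum>v\<in>S. card (L' v))"
      have "X \<union> (V - X) = V" using X(1) by blast
      then have "card (nbrs E V v) = card (nbrs E X v) + card (nbrs E (V - X) v)" for v
        using card_nbrs_Un[of X "V - X" E v] finX finV by auto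
      then have V_sum: "(\<Sum>v\<in>S. card (nbrs E V v)) = dX + dR"
        unfolding dX_def dR_def by (simp add: sum.distrib)
      have "(\<Sum>v\<in>S. k) \<le> (\<Sum>v\<in>S. card (L' v) + card (nbrs E (V - X) v))"
        using k S(1) by (intro sum_mono) blast
      then have "card S * k \<le> l + dR"
        unfolding l_def dR_def by (simp add: sum.distrib)
      then have "Suc r * (card S * k) \<le> Suc r * (l + dR)" by (rule mult_le_mono2)
      moreover have "Suc r * (dX + dR) + r * card (induced_edges E S) < Suc r * k * card S + r * dX"
        using dens[OF S] unfolding V_sum dX_def[symmetric] .
      ultimately have "dX + r * card (induced_edges E S) < Suc r * l"
        by (simp add: algebra_simps)
      then show "(\<Sum>v\<in>S. card (nbrs E X v)) + r * card (induced_edges E S)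
          < Suc r * (\<Sum>v\<in>S. card (L' v))"
        unfolding dX_def l_def .
    qed
    then obtain \<psi> where \<psi>: "list_colouring X L' \<psi>" "clustered E X c \<psi>" by blast
    let ?\<phi> = "\<lambda>v. if v \<in> X then \<psi> v else \<rho> v"
    have "clustered E V c ?\<phi>"
    proof (rule clustered_combine[OF \<open>finite V\<close> X(1) \<psi>(2) \<rho>(2)])
      fix x y assume "x \<in> X" and y: "y \<in> V - X" and e: "{x, y} \<in> E"
      then have "\<psi> x \<in> L' x" using \<psi>(1) unfolding list_colouring_def by blast
      moreover have "y \<in> nbrs E (V - X) x"
        using y e unfolding nbrs_def by (simp add: insert_commute)
      ultimately show "\<psi> x \<noteq> \<rho> y" unfolding L'_def by blast
    qed
    moreover have "list_colouring V L ?\<phi>"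
      using \<psi>(1) \<rho>(1) unfolding list_colouring_def L'_def by auto
    ultimately show ?thesis by blast
  qed
qed

lemma finite_sublists:
  assumes "list_assignment V k L"
  obtains L' where "\<And>v. v \<in> V \<Longrightarrow> L' v \<subseteq> L v \<and> finite (L' v) \<and> k \<le> card (L' v)"
proof -
  have "\<exists>M \<subseteq> L v. finite M \<and> k \<le> card M" if "v \<in> V" for v
  proof (cases "finite (L v)")
    case True
    then show ?thesis using assms that unfolding list_assignment_def by blast
  next
    case False
    then show ?thesis using infinite_arbitrarily_large[of "L v" k] by blast
  qed
  then show ?thesis using that by metis
qed

lemma list_colouring_clustered:
  fixes L :: "'a \<Rightarrow> 'c set"
  assumes E: "pair_edges E" and V: "finite V" and L: "list_assignment V k L"
    and r: "r = 1 \<or> r = 2"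
    and sparse: "\<And>S. S \<subseteq> V \<Longrightarrow> S \<noteq> {} \<Longrightarrow> (r + 2) * card (induced_edges E S) < Suc r * k * card S"
  obtains \<phi> where "list_colouring V L \<phi>" "clustered E V (Suc r) \<phi>"
proof -
  obtain L' where L': "\<And>v. v \<in> V \<Longrightarrow> L' v \<subseteq> L v \<and> finite (L' v) \<and> k \<le> card (L' v)"
    using finite_sublists[OF L] by blast
  have "\<exists>\<phi>. list_colouring V L' \<phi> \<and> clustered E V (Suc r) \<phi>"
  proof (rule colouring_by_peeling[where r = r and k = k, OF E _ V sparse])
    fix X and M :: "'a \<Rightarrow> 'c set"
    assume X: "finite X" and M: "\<And>v. v \<in> X \<Longrightarrow> finite (M v)"
      and dens: "\<And>S. S \<subseteq> X \<Longrightarrow> S \<noteq> {} \<Longrightarrow>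
          (\<Sum>v\<in>S. card (nbrs E X v)) + r * card (induced_edges E S) < Suc r * (\<Sum>v\<in>S. card (M v))"
    show "\<exists>\<phi>. list_colouring X M \<phi> \<and> clustered E X (Suc r) \<phi>"
    proof (cases "r = 1")
      case True
      have "\<exists>\<phi>. list_colouring X M \<phi> \<and> clustered E X 2 \<phi>"
      proof (rule colouring_clustering2[OF E X M])
        fix v assume "v \<in> X"
        then show "card (nbrs E X v) < 2 * card (M v)"
          using dens[of "{v}"] True by simp
      qed
      moreover have "Suc r = 2" using True by simp
      ultimately show ?thesis by metis
    next
      case False
      then have r2: "r = 2" using r by blast
      have "\<exists>\<phi>. list_colouring X M \<phi> \<and> energy E X \<phi> = min_energy E M X \<and> clustered E X 3 \<phi>"
      proof (rule colouring_clustering3[OF E X M])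
        fix S assume "S \<subseteq> X" "S \<noteq> {}"
        from dens[OF this] show "(\<Sum>v\<in>S. card (nbrs E X v)) + 2 * card (induced_edges E S)
            < 3 * (\<Sum>v\<in>S. card (M v))"
          unfolding r2 by simp
      qed
      moreover have "Suc r = 3" using r2 by simp
      ultimately show ?thesis by metis
    qed
  next
    show "finite (L' v) \<and> k \<le> card (L' v)" if "v \<in> V" for v
      using L'[OF that] by blast
  qed
  then obtain \<phi> where "list_colouring V L' \<phi>" "clustered E V (Suc r) \<phi>" by blast
  moreover have "list_colouring V L \<phi>"
    using calculation(1) L' unfolding list_colouring_def by blast
  ultimately show ?thesis using that by blast
qed

lemma has_clustering_if_clustered:
  assumes "\<And>e. e \<in> E \<Longrightarrow> e \<subseteq> V" and "clustered E V c \<phi>" "c \<le> c'"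
  shows "has_clustering V E \<phi> c'"
proof -
  have ind: "induced_edges E V = E" using assms(1) unfolding induced_edges_def by blast
  show ?thesis
    unfolding has_clustering_def graph_components_def
  proof
    fix C assume "C \<in> component_of V (mono_edges E \<phi>) ` V"
    then obtain v where "v \<in> V" "C = component_of V (mono_edges E \<phi>) v" by blast
    then have "card C \<le> c" using assms(2) unfolding clustered_def ind by blast
    then show "card C \<le> c'" using assms(3) by simp
  qed
qed

lemma has_defect_if_clustered:
  assumes E: "pair_edges E" and sub: "\<And>e. e \<in> E \<Longrightarrow> e \<subseteq> V" and V: "finite V"
    and cl: "clustered E V 2 \<phi>"
  shows "has_defect V E \<phi> 1"
  unfolding has_defect_def
proof
  fix v assume v: "v \<in> V"
  let ?M = "mono_edges E \<phi>" and ?C = "component_of V (mono_edges E \<phi>) v"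
  have "induced_edges E V = E" using sub unfolding induced_edges_def by blast
  then have C2: "card ?C \<le> 2" using cl v unfolding clustered_def by metis
  have other: "\<exists>a. e = {v, a} \<and> a \<noteq> v \<and> a \<in> ?C" if e: "e \<in> ?M" "v \<in> e" for e
  proof -
    have eE: "e \<in> E" using e(1) unfolding mono_edges_def by blast
    obtain p q where pq: "e = {p, q}" "p \<noteq> q" using pair_edgesE[OF E eE] .
    have "\<exists>a. e = {v, a} \<and> a \<noteq> v"
    proof (cases "v = p")
      case True
      then show ?thesis using pq by blast
    next
      case False
      then have "v = q" using e(2) pq(1) by blast
      then show ?thesis using pq by (metis insert_commute)
    qed
    then obtain a where a: "e = {v, a}" "a \<noteq> v" by blast
    have "a \<in> V" using sub[OF eE] a(1) by blast
    moreover have "{v, a} \<in> ?M" using e(1) a(1) by simp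
    ultimately have "a \<in> ?C"
      using component_of_step[OF component_of_refl[OF v]] by blast
    then show ?thesis using a by blast
  qed
  have same: "e = f" if e: "e \<in> ?M" "v \<in> e" and f: "f \<in> ?M" "v \<in> f" for e f
  proof (rule ccontr)
    assume "e \<noteq> f"
    obtain a b where a: "e = {v, a}" "a \<noteq> v" "a \<in> ?C" and b: "f = {v, b}" "b \<noteq> v" "b \<in> ?C"
      using other[OF e] other[OF f] by blast
    then have "a \<noteq> b" using \<open>e \<noteq> f\<close> by blast
    then have "card {v, a, b} = 3" using a(2) b(2) by (simp add: card_insert_if)
    moreover have "{v, a, b} \<subseteq> ?C" using a b component_of_refl[OF v] by blast
    moreover have "finite ?C" using V unfolding component_of_def by simp
    ultimately show False using C2 card_mono[of ?C "{v, a, b}"] by linarith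
  qed
  have "{e \<in> ?M. v \<in> e} \<subseteq> Pow V" using sub unfolding mono_edges_def by blast
  then have fin: "finite {e \<in> ?M. v \<in> e}" using V by (meson finite_Pow_iff finite_subset)
  have "card {e \<in> ?M. v \<in> e} \<le> Suc 0"
    unfolding card_le_Suc0_iff_eq[OF fin] using same by blast
  then show "degree ?M v \<le> 1" unfolding degree_def by simp
qed

section \<open>Separation of the plane by an arc\<close>

lemma sgn_log_iff:
  fixes a b :: complex
  assumes "compact S" "a \<notin> S" "b \<notin> S"
  shows "connected_component (- S) a b \<longleftrightarrow>
    (\<exists>g :: complex \<Rightarrow> real. continuous_on S g \<and> (\<forall>w\<in>S. sgn (w - a) / sgn (w - b) = exp (\<i> * of_real (g w))))"
proof -
  have *: "continuous_on S (\<lambda>w. (w - c) /\<^sub>R cmod (w - c))"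
    "(\<lambda>w. (w - c) /\<^sub>R cmod (w - c)) \<in> S \<rightarrow> sphere 0 1" if "c \<notin> S" for c
    using that by (auto intro!: continuous_intros simp: divide_simps)
  have "connected_component (- S) a b \<longleftrightarrow>
      homotopic_with_canon (\<lambda>x. True) S (sphere 0 1)
        (\<lambda>w. (w - a) /\<^sub>R cmod (w - a)) (\<lambda>w. (w - b) /\<^sub>R cmod (w - b))"
    by (rule Borsuk_maps_homotopic_in_connected_component_eq[symmetric]) (use assms in auto)
  also have "\<dots> \<longleftrightarrow> (\<exists>c. homotopic_with_canon (\<lambda>x. True) S (sphere 0 1)
      (\<lambda>w. ((w - a) /\<^sub>R cmod (w - a)) / ((w - b) /\<^sub>R cmod (w - b))) (\<lambda>x. c))"
    by (subst homotopic_circlemaps_divide) (use assms * in blast)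
  also have "\<dots> \<longleftrightarrow> (\<exists>g :: complex \<Rightarrow> real. continuous_on S g \<and>
      (\<forall>w\<in>S. sgn (w - a) / sgn (w - b) = exp (\<i> * of_real (g w))))"
    unfolding inessential_eq_continuous_logarithm_circle sgn_div_norm ..
  finally show ?thesis .
qed

lemma no_circle_log:
  fixes R :: "complex \<Rightarrow> complex" and n :: int
  assumes R: "continuous_on UNIV R" "\<And>w. R w \<noteq> 0" and r: "0 < r"
    and circle: "\<And>w. cmod (w - u) = r \<Longrightarrow> R w = sgn (w - u) powi n"
  shows "n = 0"
proof -
  obtain l where l: "continuous_on UNIV l" "\<And>w. R w = exp (l w)"
    using continuous_logarithm_on_contractible[OF R(1) contractible_UNIV R(2)] by auto
  define f where "f t = l (u + of_real r * cis t) - \<i> * of_int n * of_real t" for t :: real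
  have "continuous_on {0..2*pi} f"
    unfolding f_def
    by (intro continuous_intros continuous_on_compose2[OF l(1)]) auto
  moreover have exp1: "exp (f t) = 1" for t
  proof -
    have "sgn (of_real r * cis t) = cis t"
      using r by (simp add: sgn_div_norm norm_mult scaleR_conv_of_real)
    moreover have "R (u + of_real r * cis t) = sgn (of_real r * cis t) powi n"
      using circle[of "u + of_real r * cis t"] r by (simp add: norm_mult)
    ultimately have "exp (l (u + of_real r * cis t)) = cis (of_int n * t)"
      by (simp add: l(2) cis_power_int)
    also have "\<dots> = exp (\<i> * of_int n * of_real t)"
      by (simp add: cis_conv_exp algebra_simps)
    finally show ?thesis by (simp add: f_def exp_diff)
  qed
  moreover have "\<exists>e>0. \<forall>t. t \<in> {0..2*pi} \<and> f t \<noteq> f s \<longrightarrow> e \<le> norm (f t - f s)" for s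
  proof (intro exI[of _ "2 * pi"] conjI allI impI)
    fix t assume t: "t \<in> {0..2*pi} \<and> f t \<noteq> f s"
    have "exp (f t) = exp (f s)" using exp1 by simp
    then obtain k :: int where k: "f t = f s + (of_int (2 * k) * pi) * \<i>"
      by (auto simp: exp_eq)
    with t have "k \<noteq> 0" by auto
    then have "1 \<le> \<bar>real_of_int k\<bar>" by linarith
    then have "2 * pi * 1 \<le> 2 * pi * \<bar>real_of_int k\<bar>"
      by (intro mult_left_mono) auto
    moreover have "norm (f t - f s) = 2 * pi * \<bar>real_of_int k\<bar>"
      by (simp add: k norm_mult)
    ultimately show "2 * pi \<le> norm (f t - f s)" by simp
  qed simp
  ultimately have "f constant_on {0..2*pi}"
    by (intro continuous_discrete_range_constant) auto
  then have "f (2*pi) = f 0"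
    unfolding constant_on_def by (metis atLeastAtMost_iff order_refl pi_ge_zero mult_nonneg_nonneg zero_le_numeral)
  then show ?thesis by (simp add: f_def)
qed

lemma bounded_component_no_log:
  fixes S :: "complex set" and g :: "complex \<Rightarrow> real"
  assumes S: "compact S" and D: "D \<in> components (- S)" "bounded D"
    and u: "u \<in> D" and y: "y \<notin> S \<union> D" and z: "z \<notin> S \<union> D"
    and g: "continuous_on S g"
    and log: "\<And>w. w \<in> S \<Longrightarrow>
      exp (\<i> * of_real (g w)) = sgn (w - u) powi n * sgn (w - y) powi m * sgn (w - z) powi l"
  shows "n = 0"
proof -
  obtain G :: "complex \<Rightarrow> real" where G: "continuous_on UNIV G" "\<And>w. w \<in> S \<Longrightarrow> G w = g w"
    using Tietze_unbounded[OF g, of UNIV] S by (auto simp: compact_imp_closed)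
  have fr: "frontier D \<subseteq> S"
    using frontier_of_components_closed_complement[OF compact_imp_closed[OF S] D(1)] .
  have opD: "open D"
    using open_components[OF open_Compl[OF compact_imp_closed[OF S]] D(1)] .
  have cl: "closure D \<subseteq> D \<union> S"
    using fr opD by (auto simp: frontier_def interior_open)
  \<comment> \<open>If \<open>n \<noteq> 0\<close>, this nowhere vanishing function on the plane would wind \<open>n\<close> times
    around 0 on a large circle.\<close>
  define R where "R w = (if w \<in> D
      then exp (\<i> * of_real (G w)) * (inverse (sgn (w - y) powi m) * inverse (sgn (w - z) powi l))
      else sgn (w - u) powi n)" for w
  have "continuous_on (closure D \<union> - D) R"
    unfolding R_def
  proof (rule continuous_on_cases)
    show "continuous_on (closure D) (\<lambda>w. exp (\<i> * of_real (G w)) *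
        (inverse (sgn (w - y) powi m) * inverse (sgn (w - z) powi l)))"
      using y z cl by (intro continuous_intros continuous_on_subset[OF G(1)]) (auto simp: sgn_zero_iff)
    show "continuous_on (- D) (\<lambda>w. sgn (w - u) powi n)"
      using u by (intro continuous_intros) (auto simp: sgn_zero_iff)
    show "\<forall>w. w \<in> closure D \<and> w \<notin> D \<or> w \<in> - D \<and> w \<in> D \<longrightarrow>
        exp (\<i> * of_real (G w)) * (inverse (sgn (w - y) powi m) * inverse (sgn (w - z) powi l)) =
        sgn (w - u) powi n"
    proof (intro allI impI)
      fix w assume "w \<in> closure D \<and> w \<notin> D \<or> w \<in> - D \<and> w \<in> D"
      then have w: "w \<in> S" using cl by blast
      then have nz: "sgn (w - y) powi m \<noteq> 0" "sgn (w - z) powi l \<noteq> 0"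
        using y z by (auto simp: sgn_zero_iff)
      have cancel: "a * b * c * (inverse b * inverse c) = a" if "b \<noteq> 0" "c \<noteq> 0" for a b c :: complex
        using that by (simp add: field_simps)
      show "exp (\<i> * of_real (G w)) * (inverse (sgn (w - y) powi m) * inverse (sgn (w - z) powi l)) =
        sgn (w - u) powi n"
        unfolding G(2)[OF w] log[OF w] by (rule cancel[OF nz])
    qed
  qed (use opD in auto)
  moreover have "closure D \<union> - D = UNIV" using closure_subset by blast
  ultimately have "continuous_on UNIV R" by simp
  moreover have "R w \<noteq> 0" for w
    using y z u unfolding R_def by (auto simp: sgn_zero_iff power_int_eq_0_iff)
  moreover obtain r where r: "0 < r" "D \<subseteq> ball u r"
    using bounded_subset_ballD[OF D(2)] by blast
  moreover have "R w = sgn (w - u) powi n" if "cmod (w - u) = r" for w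
  proof -
    have "w \<notin> D" using r(2) that by (auto simp: dist_norm norm_minus_commute)
    then show ?thesis by (simp add: R_def)
  qed
  ultimately show ?thesis using no_circle_log by blast
qed

text \<open>
  If three points are pairwise separated, the quotients \<open>sgn (w - x) / sgn (w - y)\<close> and
  \<open>sgn (w - y) / sgn (w - z)\<close> have continuous logarithms on \<open>S\<close> and on the arc but not on the
  union. A suitable integer combination of the two logarithms is continuous on the union, which
  \<open>bounded_component_no_log\<close> excludes, as \<open>x\<close> or \<open>z\<close> lies in a bounded component.
\<close>
lemma arc_separates_at_most_two:
  fixes S :: "complex set"
  assumes S: "compact S" and \<gamma>: "arc \<gamma>"
    and SA: "S \<inter> path_image \<gamma> = {pathstart \<gamma>, pathfinish \<gamma>}"
    and x: "x \<notin> S \<union> path_image \<gamma>" and y: "y \<notin> S \<union> path_image \<gamma>" and z: "z \<notin> S \<union> path_image \<gamma>"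
    and xy: "connected_component (- S) x y" and yz: "connected_component (- S) y z"
  shows "connected_component (- (S \<union> path_image \<gamma>)) x y \<or>
    connected_component (- (S \<union> path_image \<gamma>)) y z \<or>
    connected_component (- (S \<union> path_image \<gamma>)) x z"
proof (rule ccontr)
  assume not: "\<not> ?thesis"
  define A where "A = path_image \<gamma>"
  define T where "T = S \<union> A"
  let ?a = "pathstart \<gamma>" and ?b = "pathfinish \<gamma>"
  have A: "compact A" "connected (- A)"
    using \<gamma> connected_arc_complement[OF \<gamma>] by (auto simp: A_def compact_arc_image)
  have T: "compact T" using S A by (simp add: T_def compact_Un)
  have ab: "?a \<in> S" "?a \<in> A" "?b \<in> S" "?b \<in> A" using SA by (auto simp: A_def)
  have notin: "x \<notin> S" "x \<notin> A" "y \<notin> S" "y \<notin> A" "z \<notin> S" "z \<notin> A" "x \<notin> T" "y \<notin> T" "z \<notin> T"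
    using x y z by (auto simp: A_def T_def)
  have conA: "connected_component (- A) p q" if "p \<notin> A" "q \<notin> A" for p q
    using A(2) that by (metis ComplI connected_iff_connected_component)
  have logs: "\<exists>(g::complex \<Rightarrow> real) (h::complex \<Rightarrow> real) (n::int). continuous_on S g \<and> continuous_on A h \<and>
      (\<forall>w\<in>S. sgn (w - p) / sgn (w - q) = exp (\<i> * of_real (g w))) \<and>
      (\<forall>w\<in>A. sgn (w - p) / sgn (w - q) = exp (\<i> * of_real (h w))) \<and>
      g ?a = h ?a \<and> g ?b = h ?b + 2 * of_int n * pi"
    if pq: "p \<notin> S" "p \<notin> A" "q \<notin> S" "q \<notin> A" and con: "connected_component (- S) p q" for p q
  proof -
    obtain g :: "complex \<Rightarrow> real" where g: "continuous_on S g"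
      "\<And>w. w \<in> S \<Longrightarrow> sgn (w - p) / sgn (w - q) = exp (\<i> * of_real (g w))"
      using con sgn_log_iff[OF S pq(1,3)] by blast
    obtain h :: "complex \<Rightarrow> real" where h: "continuous_on A h"
      "\<And>w. w \<in> A \<Longrightarrow> sgn (w - p) / sgn (w - q) = exp (\<i> * of_real (h w))"
      using conA[OF pq(2,4)] sgn_log_iff[OF A(1) pq(2,4)] by blast
    have diff: "\<exists>n::int. g w = h w + 2 * of_int n * pi" if "w \<in> S" "w \<in> A" for w
    proof -
      have "exp (\<i> * of_real (g w)) = exp (\<i> * of_real (h w))"
        using g(2)[OF that(1)] h(2)[OF that(2)] by simp
      then obtain n :: int where "\<i> * of_real (g w) = \<i> * of_real (h w) + (of_int (2 * n) * pi) * \<i>"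
        by (auto simp: exp_eq)
      then have "\<i> * of_real (g w) = \<i> * of_real (h w + 2 * of_int n * pi)"
        by (simp add: algebra_simps)
      then show ?thesis by (metis complex_i_not_zero mult_cancel_left of_real_eq_iff)
    qed
    obtain k :: int where k: "g ?a = h ?a + 2 * of_int k * pi" using diff ab by blast
    obtain l :: int where l: "g ?b = h ?b + 2 * of_int l * pi" using diff ab by blast
    define h' where "h' w = h w + 2 * of_int k * pi" for w
    have "exp (\<i> * of_real (h' w)) = exp (\<i> * of_real (h w))" for w
      unfolding exp_eq by (intro exI[of _ k]) (simp add: h'_def algebra_simps)
    then have "\<forall>w\<in>A. sgn (w - p) / sgn (w - q) = exp (\<i> * of_real (h' w))" using h(2) by simp
    moreover have "continuous_on A h'" unfolding h'_def by (intro continuous_intros h(1))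
    moreover have "g ?a = h' ?a" "g ?b = h' ?b + 2 * of_int (l - k) * pi"
      by (simp_all add: k l h'_def algebra_simps)
    ultimately show ?thesis using g by blast
  qed
  obtain g1 h1 :: "complex \<Rightarrow> real" and n1 where 1: "continuous_on S g1" "continuous_on A h1"
    "\<And>w. w \<in> S \<Longrightarrow> sgn (w - x) / sgn (w - y) = exp (\<i> * of_real (g1 w))"
    "\<And>w. w \<in> A \<Longrightarrow> sgn (w - x) / sgn (w - y) = exp (\<i> * of_real (h1 w))"
    "g1 ?a = h1 ?a" "g1 ?b = h1 ?b + 2 * of_int n1 * pi"
    using logs[OF notin(1-4) xy] by metis
  obtain g2 h2 :: "complex \<Rightarrow> real" and n2 where 2: "continuous_on S g2" "continuous_on A h2"
    "\<And>w. w \<in> S \<Longrightarrow> sgn (w - y) / sgn (w - z) = exp (\<i> * of_real (g2 w))"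
    "\<And>w. w \<in> A \<Longrightarrow> sgn (w - y) / sgn (w - z) = exp (\<i> * of_real (h2 w))"
    "g2 ?a = h2 ?a" "g2 ?b = h2 ?b + 2 * of_int n2 * pi"
    using logs[OF notin(3-6) yz] by metis
  have glue: "continuous_on T (\<lambda>w. if w \<in> S then g w else h w)"
    if "continuous_on S g" "continuous_on A h" "g ?a = h ?a" "g ?b = h ?b" for g h :: "complex \<Rightarrow> real"
    unfolding T_def
  proof (rule continuous_on_cases)
    have "w \<in> {?a, ?b}" if "w \<in> A" "w \<in> S" for w
      unfolding SA[symmetric] using that by (simp add: A_def)
    then show "\<forall>w. w \<in> S \<and> w \<notin> S \<or> w \<in> A \<and> w \<in> S \<longrightarrow> g w = h w"
      using that(3,4) by (metis empty_iff insert_iff)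
  qed (use that S A in \<open>auto simp: compact_imp_closed\<close>)
  have n1: "n1 \<noteq> 0"
  proof
    assume "n1 = 0"
    then have "continuous_on T (\<lambda>w. if w \<in> S then g1 w else h1 w)"
      using 1 by (intro glue) auto
    moreover have "\<forall>w\<in>T. sgn (w - x) / sgn (w - y) = exp (\<i> * of_real (if w \<in> S then g1 w else h1 w))"
      using 1(3,4) by (auto simp: T_def)
    ultimately have "connected_component (- T) x y"
      using sgn_log_iff[OF T notin(7,8)] by blast
    then show False using not by (simp add: T_def A_def)
  qed
  have n2: "n2 \<noteq> 0"
  proof
    assume "n2 = 0"
    then have "continuous_on T (\<lambda>w. if w \<in> S then g2 w else h2 w)"
      using 2 by (intro glue) auto
    moreover have "\<forall>w\<in>T. sgn (w - y) / sgn (w - z) = exp (\<i> * of_real (if w \<in> S then g2 w else h2 w))"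
      using 2(3,4) by (auto simp: T_def)
    ultimately have "connected_component (- T) y z"
      using sgn_log_iff[OF T notin(8,9)] by blast
    then show False using not by (simp add: T_def A_def)
  qed
  define g where "g w = of_int n2 * g1 w - of_int n1 * g2 w" for w
  define h where "h w = of_int n2 * h1 w - of_int n1 * h2 w" for w
  define k where "k w = (if w \<in> S then g w else h w)" for w
  have "continuous_on S g" "continuous_on A h"
    unfolding g_def h_def by (intro continuous_intros 1 2)+
  moreover have "g ?a = h ?a" "g ?b = h ?b"
    using 1(5,6) 2(5,6) by (simp_all add: g_def h_def algebra_simps)
  ultimately have contk: "continuous_on T k" unfolding k_def by (rule glue)
  have expk: "exp (\<i> * of_real (k w)) =
      sgn (w - x) powi n2 * sgn (w - y) powi (- n2 - n1) * sgn (w - z) powi n1" if w: "w \<in> T" for w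
  proof -
    define q1 where "q1 = (if w \<in> S then g1 w else h1 w)"
    define q2 where "q2 = (if w \<in> S then g2 w else h2 w)"
    have q1: "exp (\<i> * of_real q1) = sgn (w - x) / sgn (w - y)"
      and q2: "exp (\<i> * of_real q2) = sgn (w - y) / sgn (w - z)"
      using w 1(3,4) 2(3,4) by (auto simp: T_def q1_def q2_def)
    have nz: "sgn (w - x) \<noteq> 0" "sgn (w - y) \<noteq> 0" "sgn (w - z) \<noteq> 0"
      using w notin by (auto simp: sgn_zero_iff)
    have "\<i> * of_real (k w) = of_int n2 * (\<i> * of_real q1) + of_int (- n1) * (\<i> * of_real q2)"
      by (simp add: k_def g_def h_def q1_def q2_def algebra_simps)
    then have "exp (\<i> * of_real (k w)) = exp (\<i> * of_real q1) powi n2 * exp (\<i> * of_real q2) powi (- n1)"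
      by (simp only: exp_add exp_power_int)
    also have "\<dots> = sgn (w - x) powi n2 * sgn (w - y) powi (- n2 - n1) * sgn (w - z) powi n1"
    proof -
      have "sgn (w - y) powi (- n2 - n1) = sgn (w - y) powi (- n2) * sgn (w - y) powi (- n1)"
        using power_int_add[of "sgn (w - y)" "- n2" "- n1"] nz(2) by simp
      then show ?thesis
        unfolding q1 q2
        by (simp only: divide_inverse power_int_mult_distrib power_int_inverse power_int_minus
            inverse_mult_distrib inverse_inverse_eq mult_ac)
    qed
    finally show ?thesis .
  qed
  define C where "C p = connected_component_set (- T) p" for p
  have Cc: "C p \<in> components (- T)" "p \<in> C p" if "p \<notin> T" for p
    using that by (auto simp: C_def componentsI)
  have sep: "\<not> connected_component (- T) x y" "\<not> connected_component (- T) y z" "\<not> connected_component (- T) x z"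
    using not by (auto simp: T_def A_def)
  have "C x \<noteq> C z"
    using sep(3) Cc[OF notin(9)] by (auto simp: C_def)
  then have "bounded (C x) \<or> bounded (C z)"
    using cobounded_unique_unbounded_component[of "- T" x z] compact_imp_bounded[OF T]
    by (auto simp: C_def)
  then show False
  proof
    assume "bounded (C x)"
    moreover have "y \<notin> T \<union> C x" "z \<notin> T \<union> C x" using sep notin by (auto simp: C_def)
    ultimately have "n2 = 0"
      using bounded_component_no_log[OF T Cc(1)[OF notin(7)] _ Cc(2)[OF notin(7)] _ _ contk, of y z n2 "- n2 - n1" n1]
        expk by blast
    then show False using n2 by blast
  next
    assume "bounded (C z)"
    moreover have "y \<notin> T \<union> C z" "x \<notin> T \<union> C z"
      using sep notin by (auto simp: C_def connected_component_sym_eq)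
    ultimately have "n1 = 0"
      using bounded_component_no_log[OF T Cc(1)[OF notin(9)] _ Cc(2)[OF notin(9)] _ _ contk, of y x n1 "- n2 - n1" n2]
        expk by (simp add: mult_ac)
    then show False using n1 by blast
  qed
qed

section \<open>Edges of a planar graph\<close>

lemma clopen_in_connected_complement:
  fixes F :: "'a::topological_space set"
  assumes "connected (- U)" "F \<noteq> {}" "F \<inter> U = {}" "frontier F \<subseteq> U"
  shows "F = - U"
proof (rule ccontr)
  assume "F \<noteq> - U"
  then have "- U - F \<noteq> {}" "- U \<inter> F \<noteq> {}" using assms by auto
  then have "- U \<inter> frontier F \<noteq> {}" using connected_Int_frontier[OF assms(1)] by blast
  then show False using assms(4) by blast
qed

lemma finite_card_le_2:
  assumes "\<And>x y z. x \<in> S \<Longrightarrow> y \<in> S \<Longrightarrow> z \<in> S \<Longrightarrow> x = y \<or> y = z \<or> x = z"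
  shows "finite S \<and> card S \<le> 2"
proof -
  have "\<exists>x y. S \<subseteq> {x, y}" using assms by blast
  then obtain x y where S: "S \<subseteq> {x, y}" by blast
  then have "finite S" by (rule finite_subset) simp
  moreover have "card S \<le> card {x, y}" using S by (intro card_mono) auto
  moreover have "card {x, y} \<le> 2" by (simp add: card_insert_if)
  ultimately show ?thesis by linarith
qed

lemma component_of_complement_not_in_arc:
  fixes K :: "complex set"
  assumes K: "compact K" and \<gamma>: "arc \<gamma>"
    and KA: "K \<inter> path_image \<gamma> = {pathstart \<gamma>, pathfinish \<gamma>}"
    and D: "D \<in> components (- K)"
  shows "\<not> D \<subseteq> path_image \<gamma>"
proof
  assume sub: "D \<subseteq> path_image \<gamma>"
  let ?ab = "{pathstart \<gamma>, pathfinish \<gamma>}"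
  let ?I = "path_image \<gamma> - ?ab"
  have opD: "open D" using D K by (meson compact_imp_closed open_Compl open_components)
  have DK: "D \<subseteq> - K" using D by (rule in_components_subset)
  have D_I: "D \<subseteq> ?I" using sub DK KA by blast
  have Dne: "D \<noteq> {}" using D by (rule in_components_nonempty)
  have "connected ?I" using \<gamma> connected_simple_path_endless arc_imp_simple_path by blast
  moreover have "?I \<subseteq> - K" using KA by blast
  ultimately have "?I \<subseteq> D" using D D_I Dne by (intro components_maximal[OF D]) auto
  then have DI: "D = ?I" using D_I by blast
  have "closure D \<subseteq> path_image \<gamma>"
    using sub \<gamma> by (meson closed_arc_image closure_minimal)
  then have "frontier D \<subseteq> ?ab"
    using opD DI by (auto simp: frontier_def interior_open)
  moreover have "connected (- ?ab)"
    using connected_open_delete_finite[of "UNIV :: complex set" ?ab] connected_UNIV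
    by (simp add: Compl_eq_Diff_UNIV)
  ultimately have "D = - ?ab"
    using Dne DI by (intro clopen_in_connected_complement) auto
  moreover have "bounded D"
    using sub \<gamma> by (meson bounded_arc_image bounded_subset)
  moreover have "\<not> bounded (- ?ab)"
    by (rule cobounded_imp_unbounded) (simp add: finite_imp_bounded)
  ultimately show False by simp
qed

locale arc_attached =
  fixes K :: "complex set" and \<gamma> :: "real \<Rightarrow> complex"
  assumes K: "compact K" and \<gamma>: "arc \<gamma>"
    and KA: "K \<inter> path_image \<gamma> = {pathstart \<gamma>, pathfinish \<gamma>}"
begin

abbreviation "K' \<equiv> K \<union> path_image \<gamma>"

lemma at_most_two_faces:
  assumes D: "D \<in> components (- K)"
    and C: "C1 \<in> components (- K')" "C2 \<in> components (- K')" "C3 \<in> components (- K')"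
      "C1 \<subseteq> D" "C2 \<subseteq> D" "C3 \<subseteq> D"
  shows "C1 = C2 \<or> C2 = C3 \<or> C1 = C3"
proof -
  obtain x where x: "x \<in> C1" using in_components_nonempty[OF C(1)] by blast
  obtain y where y: "y \<in> C2" using in_components_nonempty[OF C(2)] by blast
  obtain z where z: "z \<in> C3" using in_components_nonempty[OF C(3)] by blast
  have notin: "x \<notin> K'" "y \<notin> K'" "z \<notin> K'"
    using x in_components_subset[OF C(1)] y in_components_subset[OF C(2)]
      z in_components_subset[OF C(3)] by blast+
  have con: "connected_component (- K) p q" if "p \<in> D" "q \<in> D" for p q
    unfolding connected_component_def
    using in_components_connected[OF D] in_components_subset[OF D] that by blast
  have same: "A = B" if pq: "connected_component (- K') p q" and "p \<in> A" "q \<in> B"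
    and A: "A \<in> components (- K')" and B: "B \<in> components (- K')" for p q A B
  proof -
    obtain T where T: "connected T" "T \<subseteq> - K'" "p \<in> T" "q \<in> T"
      using pq unfolding connected_component_def by blast
    have "A \<inter> T \<noteq> {}" "B \<inter> T \<noteq> {}" using that(2,3) T(3,4) by blast+
    then have "T \<subseteq> A" "T \<subseteq> B"
      using components_maximal[OF A T(1,2)] components_maximal[OF B T(1,2)] by simp_all
    then have "A \<inter> B \<noteq> {}" using T(3) by blast
    then show ?thesis using components_eq[OF A B] by simp
  qed
  have "connected_component (- K) x y" "connected_component (- K) y z"
    using con x y z C(4-6) by blast+
  from arc_separates_at_most_two[OF K \<gamma> KA notin this]
  show ?thesis
    using same[OF _ x y C(1,2)] same[OF _ y z C(2,3)] same[OF _ x z C(1,3)] by metis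
qed

definition parent :: "complex set \<Rightarrow> complex set" where
  "parent C = (SOME D. D \<in> components (- K) \<and> C \<subseteq> D)"

lemma parent:
  assumes C: "C \<in> components (- K')"
  shows "parent C \<in> components (- K)" "C \<subseteq> parent C"
proof -
  have "connected C" "C \<subseteq> - K" "C \<noteq> {}"
    using in_components_connected[OF C] in_components_subset[OF C] in_components_nonempty[OF C] by blast+
  then have "\<exists>D. D \<in> components (- K) \<and> C \<subseteq> D"
    using exists_component_superset[of C "- K"] by blast
  then show "parent C \<in> components (- K)" "C \<subseteq> parent C"
    unfolding parent_def by (metis (mono_tags, lifting) someI_ex)+
qed

lemma parent_eq:
  assumes "C \<in> components (- K')" "D \<in> components (- K)" "w \<in> C" "w \<in> D"
  shows "parent C = D"
  using parent[OF assms(1)] assms components_eq[of "parent C" "- K" D] by blast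

lemma parent_surj: "parent ` components (- K') = components (- K)"
proof
  show "parent ` components (- K') \<subseteq> components (- K)" using parent(1) by blast
  show "components (- K) \<subseteq> parent ` components (- K')"
  proof
    fix D assume D: "D \<in> components (- K)"
    obtain w where w: "w \<in> D" "w \<notin> path_image \<gamma>"
      using component_of_complement_not_in_arc[OF K \<gamma> KA D] by blast
    then have "w \<in> - K'" using in_components_subset[OF D] by blast
    then have C: "connected_component_set (- K') w \<in> components (- K')"
      "w \<in> connected_component_set (- K') w"
      by (auto simp: componentsI)
    then show "D \<in> parent ` components (- K')"
      using parent_eq[OF C(1) D C(2) w(1)] by blast
  qed
qed

lemma finite_faces:
  assumes "finite (components (- K))"
  shows "finite (components (- K'))"
proof -
  have "finite {C \<in> components (- K'). parent C = D}" if D: "D \<in> components (- K)" for D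
  proof (rule conjunct1[OF finite_card_le_2])
    fix x y z
    assume "x \<in> {C \<in> components (- K'). parent C = D}" "y \<in> {C \<in> components (- K'). parent C = D}"
      "z \<in> {C \<in> components (- K'). parent C = D}"
    then show "x = y \<or> y = z \<or> x = z"
      using at_most_two_faces[OF D, of x y z] parent(2) by blast
  qed
  moreover have "components (- K') = (\<Union>D\<in>components (- K). {C \<in> components (- K'). parent C = D})"
    using parent(1) by blast
  ultimately show ?thesis using assms by (metis (no_types, lifting) finite_UN)
qed

lemma card_faces_mono:
  assumes "finite (components (- K))"
  shows "card (components (- K)) \<le> card (components (- K'))"
  using card_image_le[OF finite_faces[OF assms], of parent] parent_surj by simp

lemma card_faces_cycle:
  assumes fin: "finite (components (- K))"
    and path: "path_component K (pathstart \<gamma>) (pathfinish \<gamma>)"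
  shows "card (components (- K)) < card (components (- K'))"
proof -
  let ?a = "pathstart \<gamma>" and ?b = "pathfinish \<gamma>"
  have ab: "?a \<noteq> ?b" using arc_distinct_ends[OF \<gamma>] by simp
  obtain g where g: "path g" "path_image g \<subseteq> K" "pathstart g = ?b" "pathfinish g = ?a"
    using path_component_sym[OF path] unfolding path_component_def by blast
  obtain q where q: "arc q" "path_image q \<subseteq> K" "pathstart q = ?b" "pathfinish q = ?a"
    using path_contains_arc[OF g(1,3,4)] ab g(2) by (metis order_trans)
  let ?J = "\<gamma> +++ q"
  have J: "simple_path ?J" "pathfinish ?J = pathstart ?J"
    using \<gamma> q KA by (auto intro!: simple_path_join_loop)
  have imJ: "path_image ?J = path_image \<gamma> \<union> path_image q"
    using q by (simp add: path_image_join)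
  have JK: "path_image ?J \<subseteq> K'" using imJ q(2) by blast
  note jordan = Jordan_inside_outside[OF J]
  have "path_image \<gamma> - {?a, ?b} \<noteq> {}"
    using \<gamma> nonempty_simple_path_endless arc_imp_simple_path by blast
  then obtain w where w: "w \<in> path_image \<gamma>" "w \<noteq> ?a" "w \<noteq> ?b" by blast
  then have wK: "w \<in> - K" using KA by blast
  define D where "D = connected_component_set (- K) w"
  have D: "D \<in> components (- K)" "w \<in> D" using wK by (auto simp: D_def componentsI)
  have opD: "open D" using D K by (meson compact_imp_closed open_Compl open_components)
  have wJ: "w \<in> path_image ?J" using w imJ by blast
  have "w \<in> closure (inside (path_image ?J))" "w \<in> closure (outside (path_image ?J))"
    using jordan wJ unfolding frontier_def by blast+
  then have "D \<inter> inside (path_image ?J) \<noteq> {}" "D \<inter> outside (path_image ?J) \<noteq> {}"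
    using open_Int_closure_eq_empty[OF opD] D(2) by blast+
  then obtain x y where x: "x \<in> D" "x \<in> inside (path_image ?J)" and y: "y \<in> D" "y \<in> outside (path_image ?J)"
    by blast
  have "x \<notin> K" "y \<notin> K" using x(1) y(1) in_components_subset[OF D(1)] by blast+
  moreover have "x \<notin> path_image \<gamma>" "y \<notin> path_image \<gamma>"
    using x(2) y(2) imJ inside_no_overlap[of "path_image ?J"] outside_no_overlap[of "path_image ?J"]
    by blast+
  ultimately have "x \<notin> K'" "y \<notin> K'" by blast+
  define C1 where "C1 = connected_component_set (- K') x"
  define C2 where "C2 = connected_component_set (- K') y"
  have C: "C1 \<in> components (- K')" "x \<in> C1" "C2 \<in> components (- K')" "y \<in> C2"
    using \<open>x \<notin> K'\<close> \<open>y \<notin> K'\<close> by (auto simp: C1_def C2_def componentsI)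
  have "C1 \<noteq> C2"
  proof
    assume "C1 = C2"
    have "connected C1" "C1 \<subseteq> - K'"
      using in_components_connected[OF C(1)] in_components_subset[OF C(1)] by blast+
    have "x \<in> C1 \<inter> inside (path_image ?J)" using C(2) x(2) by blast
    moreover have "y \<in> C1 - inside (path_image ?J)"
      using C(4) \<open>C1 = C2\<close> y(2) jordan by blast
    ultimately have "C1 \<inter> frontier (inside (path_image ?J)) \<noteq> {}"
      using connected_Int_frontier[OF \<open>connected C1\<close>] by blast
    moreover have "frontier (inside (path_image ?J)) = path_image ?J" using jordan by blast
    ultimately show False using JK \<open>C1 \<subseteq> - K'\<close> by auto
  qed
  moreover have "parent C1 = parent C2"
    using parent_eq[OF C(1) D(1) C(2) x(1)] parent_eq[OF C(3) D(1) C(4) y(1)] by simp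
  ultimately have "\<not> inj_on parent (components (- K'))"
    using C unfolding inj_on_def by blast
  then have "card (parent ` components (- K')) \<noteq> card (components (- K'))"
    using eq_card_imp_inj_on[OF finite_faces[OF fin]] by blast
  then show ?thesis
    using card_image_le[OF finite_faces[OF fin], of parent] parent_surj by simp
qed

end

definition drawn_set ::
    "'a set \<Rightarrow> ('a \<Rightarrow> complex) \<Rightarrow> ('a set \<Rightarrow> real \<Rightarrow> complex) \<Rightarrow> 'a set set \<Rightarrow> complex set" where
  "drawn_set V p \<gamma> F = p ` V \<union> (\<Union>e\<in>F. path_image (\<gamma> e))"

locale drawing =
  fixes V :: "'a set" and E :: "'a set set" and p \<gamma>
  assumes graph: "simple_graph V E" and draw: "plane_drawing V E p \<gamma>"
begin

abbreviation "G F \<equiv> drawn_set V p \<gamma> F"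

lemma finite_V: "finite V"
  using graph unfolding simple_graph_def by blast

lemma edge_sub: "e \<in> E \<Longrightarrow> e \<subseteq> V" and edge_card: "e \<in> E \<Longrightarrow> card e = 2"
  using graph unfolding simple_graph_def by blast+

lemma finite_E: "finite E"
  using finite_subset[of E "Pow V"] finite_V edge_sub by blast

lemma arc_edge: "e \<in> E \<Longrightarrow> arc (\<gamma> e)"
  and ends_edge: "e \<in> E \<Longrightarrow> {pathstart (\<gamma> e), pathfinish (\<gamma> e)} = p ` e"
  and edge_vertices: "e \<in> E \<Longrightarrow> path_image (\<gamma> e) \<inter> p ` V = p ` e"
  and edge_edge: "e \<in> E \<Longrightarrow> f \<in> E \<Longrightarrow> e \<noteq> f \<Longrightarrow> path_image (\<gamma> e) \<inter> path_image (\<gamma> f) = p ` (e \<inter> f)"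
  using draw unfolding plane_drawing_def by blast+

lemma compact_G:
  assumes "F \<subseteq> E"
  shows "compact (G F)"
proof -
  have "finite F" using assms finite_E finite_subset by blast
  moreover have "compact (path_image (\<gamma> e))" if "e \<in> F" for e
    using that assms arc_edge compact_arc_image by blast
  ultimately show ?thesis
    unfolding drawn_set_def using finite_V by (intro compact_Un compact_UN) (auto intro: finite_imp_compact)
qed

lemma G_Int_edge:
  assumes "F \<subseteq> E" "e \<in> E" "e \<notin> F"
  shows "G F \<inter> path_image (\<gamma> e) = p ` e"
proof
  show "G F \<inter> path_image (\<gamma> e) \<subseteq> p ` e"
  proof
    fix w assume w: "w \<in> G F \<inter> path_image (\<gamma> e)"
    then consider "w \<in> p ` V" | f where "f \<in> F" "w \<in> path_image (\<gamma> f)"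
      unfolding drawn_set_def by blast
    then show "w \<in> p ` e"
    proof cases
      case 1
      then show ?thesis using w edge_vertices[OF assms(2)] by blast
    next
      case 2
      then have "w \<in> p ` (e \<inter> f)"
        using w edge_edge[of e f] assms by blast
      then show ?thesis by blast
    qed
  qed
  show "p ` e \<subseteq> G F \<inter> path_image (\<gamma> e)"
    using edge_vertices[OF assms(2)] unfolding drawn_set_def by blast
qed

lemma G_insert: "G (insert e F) = G F \<union> path_image (\<gamma> e)"
  unfolding drawn_set_def by auto

lemma arc_attached_edge:
  assumes "F \<subseteq> E" "e \<in> E" "e \<notin> F"
  shows "arc_attached (G F) (\<gamma> e)"
  using compact_G[OF assms(1)] arc_edge[OF assms(2)] G_Int_edge[OF assms] ends_edge[OF assms(2)]
  by unfold_locales auto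

definition path_classes :: "'a set set \<Rightarrow> complex set set" where
  "path_classes F = (\<lambda>v. path_component_set (G F) (p v)) ` V"

lemma vertex_in_G: "v \<in> V \<Longrightarrow> p v \<in> G F"
  unfolding drawn_set_def by blast

lemma path_classes_insert:
  shows "card (path_classes (insert e F)) \<le> card (path_classes F)"
    and "\<lbrakk>F \<subseteq> E; e \<in> E; \<not> path_component (G F) (pathstart (\<gamma> e)) (pathfinish (\<gamma> e))\<rbrakk>
      \<Longrightarrow> card (path_classes (insert e F)) < card (path_classes F)"
proof -
  let ?K = "G F" and ?K' = "G (insert e F)"
  define h where "h X = (\<Union>w\<in>X. path_component_set ?K' w)" for X
  have sub: "?K \<subseteq> ?K'" unfolding G_insert by blast
  have h: "h (path_component_set ?K (p v)) = path_component_set ?K' (p v)" if v: "v \<in> V" for v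
  proof -
    have eq: "path_component_set ?K' w = path_component_set ?K' (p v)"
      if "w \<in> path_component_set ?K (p v)" for w
    proof -
      have "path_component ?K' (p v) w"
        using that path_component_of_subset[OF sub, of "p v" w] by simp
      then show ?thesis using path_component_eq[of w ?K' "p v"] by simp
    qed
    have "p v \<in> path_component_set ?K (p v)"
      using path_component_refl[OF vertex_in_G[OF v]] by simp
    then have "(\<lambda>w. path_component_set ?K' w) ` path_component_set ?K (p v) = {path_component_set ?K' (p v)}"
      using eq by (intro equalityI subsetI) blast+
    then show ?thesis unfolding h_def by simp
  qed
  have im: "path_classes (insert e F) = h ` path_classes F"
    unfolding path_classes_def image_image by (rule image_cong[OF refl]) (rule h[symmetric])
  have fin: "finite (path_classes F)" unfolding path_classes_def using finite_V by simp
  show le: "card (path_classes (insert e F)) \<le> card (path_classes F)"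
    unfolding im by (rule card_image_le[OF fin])
  assume F: "F \<subseteq> E" and e: "e \<in> E"
    and no: "\<not> path_component ?K (pathstart (\<gamma> e)) (pathfinish (\<gamma> e))"
  obtain a b where ab: "a \<in> V" "b \<in> V" "p a = pathstart (\<gamma> e)" "p b = pathfinish (\<gamma> e)"
  proof -
    have "pathstart (\<gamma> e) \<in> p ` e" "pathfinish (\<gamma> e) \<in> p ` e"
      unfolding ends_edge[OF e, symmetric] by simp_all
    then obtain a b where "a \<in> e" "b \<in> e" "pathstart (\<gamma> e) = p a" "pathfinish (\<gamma> e) = p b"
      by (elim imageE)
    then show ?thesis using that[of a b] edge_sub[OF e] by auto
  qed
  have ne: "path_component_set ?K (p a) \<noteq> path_component_set ?K (p b)"
  proof
    assume eq: "path_component_set ?K (p a) = path_component_set ?K (p b)"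
    have "p b \<in> path_component_set ?K (p b)"
      using path_component_refl[OF vertex_in_G[OF ab(2)]] by simp
    then have "p b \<in> path_component_set ?K (p a)" unfolding eq .
    then show False using no ab(3,4) by simp
  qed
  have "path_component ?K' (p a) (p b)"
    unfolding path_component_def
  proof (intro exI conjI)
    show "path (\<gamma> e)" using arc_edge[OF e] arc_imp_path by blast
    show "path_image (\<gamma> e) \<subseteq> ?K'" unfolding G_insert by blast
  qed (use ab in auto)
  then have "h (path_component_set ?K (p a)) = h (path_component_set ?K (p b))"
    unfolding h[OF ab(1)] h[OF ab(2)] using path_component_eq[of "p b" ?K' "p a"] by simp
  then have "\<not> inj_on h (path_classes F)"
    using ne imageI[OF ab(1)] imageI[OF ab(2)] unfolding path_classes_def by (meson inj_onD)
  then have "card (h ` path_classes F) \<noteq> card (path_classes F)"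
    using eq_card_imp_inj_on[OF fin] by blast
  then show "card (path_classes (insert e F)) < card (path_classes F)"
    using le unfolding im by linarith
qed

lemma euler_lower_bound:
  assumes "F \<subseteq> E"
  shows "finite (components (- G F)) \<and>
    1 + card F + card (path_classes F) \<le> card V + card (components (- G F))"
proof -
  have "finite F" using assms finite_E finite_subset by blast
  then show ?thesis using assms
  proof (induction F rule: finite_induct)
    case empty
    have G0: "G {} = p ` V" unfolding drawn_set_def by simp
    have "- G {} = UNIV - p ` V" unfolding G0 by blast
    then have "connected (- G {})"
      using connected_open_delete_finite[of "UNIV :: complex set" "p ` V"] finite_V connected_UNIV by simp
    moreover have "- G {} \<noteq> {}"
    proof
      assume "- G {} = {}"
      then have "p ` V = UNIV" unfolding G0 by blast
      then have "finite (UNIV :: complex set)" using finite_V by (metis finite_imageI)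
      then show False using infinite_UNIV_char_0 by blast
    qed
    ultimately have "components (- G {}) = {- G {}}"
      by (simp only: components_eq_sing_iff simp_thms)
    moreover have "card (path_classes {}) \<le> card V"
      unfolding path_classes_def using finite_V by (rule card_image_le)
    ultimately show ?case by simp
  next
    case (insert e F)
    have F: "F \<subseteq> E" and e: "e \<in> E" using insert.prems by auto
    interpret arc_attached "G F" "\<gamma> e" using arc_attached_edge[OF F e insert.hyps(2)] .
    have IH: "finite (components (- G F))"
      "1 + card F + card (path_classes F) \<le> card V + card (components (- G F))"
      using insert.IH[OF F] by auto
    have fin: "finite (components (- G (insert e F)))"
      unfolding G_insert by (rule finite_faces[OF IH(1)])
    have "1 + card F + card (path_classes F) + 1 + card (path_classes (insert e F))
        \<le> card V + card (components (- G (insert e F))) + card (path_classes F)"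
    proof (cases "path_component (G F) (pathstart (\<gamma> e)) (pathfinish (\<gamma> e))")
      case True
      have "card (components (- G F)) < card (components (- G (insert e F)))"
        unfolding G_insert by (rule card_faces_cycle[OF IH(1) True])
      then show ?thesis using IH(2) path_classes_insert(1)[of e F] by linarith
    next
      case False
      have "card (components (- G F)) \<le> card (components (- G (insert e F)))"
        unfolding G_insert by (rule card_faces_mono[OF IH(1)])
      then show ?thesis using IH(2) path_classes_insert(2)[OF F e False] by linarith
    qed
    then show ?case using fin insert.hyps by simp
  qed
qed

definition inner_edge :: "'a set \<Rightarrow> complex set" where
  "inner_edge e = path_image (\<gamma> e) - p ` e"

definition incident :: "complex set \<Rightarrow> 'a set \<Rightarrow> bool" where
  "incident D e \<longleftrightarrow> closure D \<inter> inner_edge e \<noteq> {}"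

lemma inner_edge:
  assumes e: "e \<in> E"
  shows "connected (inner_edge e)" "inner_edge e \<noteq> {}"
proof -
  have "simple_path (\<gamma> e)" using arc_edge[OF e] arc_imp_simple_path by blast
  then show "connected (inner_edge e)" "inner_edge e \<noteq> {}"
    unfolding inner_edge_def ends_edge[OF e, symmetric]
    using connected_simple_path_endless[OF \<open>simple_path (\<gamma> e)\<close>]
      nonempty_simple_path_endless[OF \<open>simple_path (\<gamma> e)\<close>] by simp_all
qed

lemma edge_incident_at_most_two:
  assumes e: "e \<in> E"
  shows "card {D \<in> components (- G E). incident D e} \<le> 2"
proof (rule conjunct2[OF finite_card_le_2])
  let ?F = "E - {e}"
  have F: "?F \<subseteq> E" "e \<notin> ?F" and GE: "G E = G ?F \<union> path_image (\<gamma> e)"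
    using e G_insert[of e ?F] by (auto simp: insert_absorb)
  interpret arc_attached "G ?F" "\<gamma> e" using arc_attached_edge[OF F(1) e F(2)] .
  have disj: "inner_edge e \<subseteq> - G ?F"
    using G_Int_edge[OF F(1) e F(2)] unfolding inner_edge_def by blast
  obtain D where D: "D \<in> components (- G ?F)" "inner_edge e \<subseteq> D"
    using exists_component_superset[OF disj _ inner_edge(1)[OF e]] inner_edge(2)[OF e] disj by blast
  have opD: "open D"
    using open_components[OF _ D(1)] compact_G[OF F(1)] by (simp add: compact_imp_closed open_Compl)
  have sub: "C \<subseteq> D" if C: "C \<in> components (- G E)" and inc: "incident C e" for C
  proof (rule components_maximal[OF D(1)])
    show "connected C" using in_components_connected[OF C] .
    show "C \<subseteq> - G ?F" using in_components_subset[OF C] unfolding GE by blast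
    have "D \<inter> closure C \<noteq> {}" using inc D(2) unfolding incident_def by blast
    then show "D \<inter> C \<noteq> {}" using open_Int_closure_eq_empty[OF opD] by blast
  qed
  fix x y z
  assume "x \<in> {D \<in> components (- G E). incident D e}" "y \<in> {D \<in> components (- G E). incident D e}"
    "z \<in> {D \<in> components (- G E). incident D e}"
  then show "x = y \<or> y = z \<or> x = z"
    using at_most_two_faces[OF D(1), of x y z] sub unfolding GE by blast
qed

lemma connected_complement_two_edges:
  assumes "e \<in> E" "f \<in> E"
  shows "connected (- G {e, f})"
proof -
  have two: "connected (- (path_image (\<gamma> e) \<union> path_image (\<gamma> f)))"
  proof (cases "e = f")
    case True
    then show ?thesis using connected_arc_complement[OF arc_edge[OF assms(1)]] by simp
  next
    case False
    have "connected (path_image (\<gamma> e) \<inter> path_image (\<gamma> f))"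
    proof -
      have two: "card e = 2" "card f = 2" using edge_card assms by blast+
      then have fin: "finite e" "finite f" by (simp_all add: card_ge_0_finite)
      have "card (e \<inter> f) < 2"
      proof (rule ccontr)
        assume "\<not> ?thesis"
        then have "card e \<le> card (e \<inter> f)" "card f \<le> card (e \<inter> f)" using two by simp_all
        then have "e \<inter> f = e" "e \<inter> f = f"
          using card_seteq[OF fin(1) Int_lower1] card_seteq[OF fin(2) Int_lower2] by blast+
        then show False using False by blast
      qed
      then have "card (e \<inter> f) = 0 \<or> card (e \<inter> f) = 1" by linarith
      then consider "e \<inter> f = {}" | a where "e \<inter> f = {a}"
        using fin by (auto simp: card_1_singleton_iff)
      then show ?thesis unfolding edge_edge[OF assms False] by cases simp_all
    qed
    then show ?thesis
      using arc_edge[OF assms(1)] arc_edge[OF assms(2)]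
      by (intro Janiszewski_connected connected_arc_complement compact_arc_image closed_arc_image) simp_all
  qed
  have "open (- (path_image (\<gamma> e) \<union> path_image (\<gamma> f)))"
    using closed_arc_image[OF arc_edge] assms by (intro open_Compl closed_Un) blast+
  then have "connected (- (path_image (\<gamma> e) \<union> path_image (\<gamma> f)) - p ` V)"
    using two finite_V by (intro connected_open_delete_finite) auto
  moreover have "- G {e, f} = - (path_image (\<gamma> e) \<union> path_image (\<gamma> f)) - p ` V"
    unfolding drawn_set_def by auto
  ultimately show ?thesis by simp
qed

lemma face_incident_at_least_three:
  assumes D: "D \<in> components (- G E)" and m: "3 \<le> card E"
  shows "3 \<le> card {e \<in> E. incident D e}"
proof (rule ccontr)
  let ?I = "{e \<in> E. incident D e}"
  assume "\<not> ?thesis"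
  then have I2: "card ?I \<le> 2" by simp
  have finI: "finite ?I" using finite_E by simp
  have Ene: "E \<noteq> {}" using m by auto
  have "\<exists>e f. e \<in> E \<and> f \<in> E \<and> ?I \<subseteq> {e, f}"
  proof -
    consider "card ?I = 0" | "card ?I = 1" | "card ?I = 2" using I2 by linarith
    then show ?thesis
    proof cases
      case 1
      then have "?I = {}" using finI by simp
      then show ?thesis using Ene by blast
    next
      case 2
      then obtain e where "?I = {e}" by (auto simp: card_1_singleton_iff)
      then show ?thesis by blast
    next
      case 3
      then obtain e f where "?I = {e, f}" by (auto simp: card_2_iff)
      then show ?thesis by blast
    qed
  qed
  then obtain e f where ef: "e \<in> E" "f \<in> E" "?I \<subseteq> {e, f}" by blast
  have GE: "closed (G E)" using compact_G by (simp add: compact_imp_closed)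
  have "frontier D \<subseteq> G {e, f}"
  proof
    fix w assume w: "w \<in> frontier D"
    then have wG: "w \<in> G E"
      using frontier_of_components_closed_complement[OF GE D] by blast
    show "w \<in> G {e, f}"
    proof (cases "w \<in> p ` V")
      case True
      then show ?thesis unfolding drawn_set_def by blast
    next
      case False
      then obtain g where g: "g \<in> E" "w \<in> path_image (\<gamma> g)"
        using wG unfolding drawn_set_def by blast
      then have "w \<in> inner_edge g"
        using False edge_vertices[OF g(1)] unfolding inner_edge_def by blast
      then have "incident D g" using w unfolding incident_def frontier_def by blast
      then have "g \<in> {e, f}" using g(1) ef(3) by blast
      then show ?thesis using g(2) unfolding drawn_set_def by blast
    qed
  qed
  moreover have "D \<inter> G {e, f} = {}"
    using in_components_subset[OF D] ef unfolding drawn_set_def by blast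
  ultimately have D_eq: "D = - G {e, f}"
    using connected_complement_two_edges[OF ef(1,2)] in_components_nonempty[OF D]
    by (intro clopen_in_connected_complement)
  have "\<not> E \<subseteq> {e, f}"
  proof
    assume "E \<subseteq> {e, f}"
    then have "card E \<le> card {e, f}" by (intro card_mono) auto
    also have "\<dots> \<le> 2" by (simp add: card_insert_if)
    finally show False using m by simp
  qed
  then obtain g where g: "g \<in> E" "g \<notin> {e, f}" by blast
  obtain w where w: "w \<in> inner_edge g" using inner_edge(2)[OF g(1)] by blast
  have "{e, f} \<subseteq> E" using ef by blast
  from G_Int_edge[OF this g] have "w \<notin> G {e, f}"
    using w unfolding inner_edge_def by blast
  then have "w \<in> D" unfolding D_eq by blast
  moreover have "w \<in> G E" using w g(1) unfolding inner_edge_def drawn_set_def by blast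
  ultimately show False using in_components_subset[OF D] by blast
qed

lemma card_edges_lt:
  assumes "V \<noteq> {}"
  shows "card E < 3 * card V"
proof (cases "3 \<le> card E")
  case True
  let ?C = "components (- G E)"
  have fin: "finite ?C" and low: "1 + card E + card (path_classes E) \<le> card V + card ?C"
    using euler_lower_bound[of E] by auto
  have "card (path_classes E) \<noteq> 0"
    using assms finite_V unfolding path_classes_def by simp
  have "3 * card ?C = (\<Sum>D\<in>?C. 3)" by simp
  also have "\<dots> \<le> (\<Sum>D\<in>?C. card {e \<in> E. incident D e})"
    by (intro sum_mono face_incident_at_least_three True)
  also have "\<dots> = (\<Sum>e\<in>E. card {D \<in> ?C. incident D e})"
    using sum_multicount_gen[OF fin finite_E, of "\<lambda>D e. incident D e" "\<lambda>e. card {D \<in> ?C. incident D e}"]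
    by simp
  also have "\<dots> \<le> (\<Sum>e\<in>E. 2)"
    by (intro sum_mono edge_incident_at_most_two)
  finally have "3 * card ?C \<le> 2 * card E" by simp
  then show ?thesis using low \<open>card (path_classes E) \<noteq> 0\<close> by linarith
next
  case False
  have "card V \<noteq> 0" using assms finite_V by simp
  then show ?thesis using False by linarith
qed

end

lemma planar_card_edges_lt:
  assumes "simple_graph V E" "planar V E" "V \<noteq> {}"
  shows "card E < 3 * card V"
proof -
  obtain p \<gamma> where "plane_drawing V E p \<gamma>" using assms(2) unfolding planar_def by blast
  then interpret drawing V E p \<gamma> using assms(1) by unfold_locales
  show ?thesis using card_edges_lt assms(3) .
qed

lemma planar_induced:
  assumes "simple_graph V E" "planar V E"
  shows "simple_graph (V \<inter> S) (induced_edges E S)" "planar (V \<inter> S) (induced_edges E S)"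
proof -
  have V: "finite V" and E: "\<And>e. e \<in> E \<Longrightarrow> e \<subseteq> V" "\<And>e. e \<in> E \<Longrightarrow> card e = 2"
    using assms(1) unfolding simple_graph_def by blast+
  have sub: "e \<subseteq> V \<inter> S" "e \<in> E" if "e \<in> induced_edges E S" for e
    using that E(1)[of e] unfolding induced_edges_def by simp_all
  show "simple_graph (V \<inter> S) (induced_edges E S)"
    unfolding simple_graph_def using V sub(1) E(2)[OF sub(2)] by simp
  obtain p \<gamma> where d: "plane_drawing V E p \<gamma>" using assms(2) unfolding planar_def by blast
  interpret drawing V E p \<gamma> using assms(1) d by unfold_locales
  have "plane_drawing (V \<inter> S) (induced_edges E S) p \<gamma>"
    unfolding plane_drawing_def
  proof (intro conjI ballI impI)
    have "inj_on p V" using d unfolding plane_drawing_def by blast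
    then show "inj_on p (V \<inter> S)" by (rule inj_on_subset) simp
    fix e assume e: "e \<in> induced_edges E S"
    show "arc (\<gamma> e)" "{pathstart (\<gamma> e), pathfinish (\<gamma> e)} = p ` e"
      using arc_edge[OF sub(2)[OF e]] ends_edge[OF sub(2)[OF e]] .
    show "path_image (\<gamma> e) \<inter> p ` (V \<inter> S) = p ` e"
      using edge_vertices[OF sub(2)[OF e]] sub(1)[OF e] by blast
    fix f assume f: "f \<in> induced_edges E S" and "e \<noteq> f"
    then show "path_image (\<gamma> e) \<inter> path_image (\<gamma> f) = p ` (e \<inter> f)"
      using edge_edge[OF sub(2)[OF e] sub(2)[OF f]] by simp
  qed
  then show "planar (V \<inter> S) (induced_edges E S)" unfolding planar_def by blast
qed

lemma card_induced_edges_lt: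
  assumes un: "union_of_planar_subgraphs t V E" and t: "t \<ge> 1" and S: "finite S" "S \<noteq> {}"
  shows "card (induced_edges E S) < 3 * t * card S"
proof -
  obtain W F where WF: "\<And>i. i < t \<Longrightarrow> simple_graph (W i) (F i) \<and> planar (W i) (F i)"
    and E: "(\<Union>i<t. F i) = E"
    using un unfolding union_of_planar_subgraphs_def by blast
  have lt: "card (induced_edges (F i) S) < 3 * card S" if i: "i < t" for i
  proof (cases "W i \<inter> S = {}")
    case True
    have "simple_graph (W i \<inter> S) (induced_edges (F i) S)"
      using planar_induced(1) WF[OF i] by blast
    then have "e \<subseteq> {} \<and> card e = 2" if "e \<in> induced_edges (F i) S" for e
      using that unfolding simple_graph_def True by blast
    then have "induced_edges (F i) S = {}" by fastforce
    then show ?thesis using S by (simp add: card_gt_0_iff)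
  next
    case False
    have "card (induced_edges (F i) S) < 3 * card (W i \<inter> S)"
      using planar_card_edges_lt[OF planar_induced False] WF[OF i] by blast
    also have "\<dots> \<le> 3 * card S"
      using S(1) by (simp add: card_mono)
    finally show ?thesis .
  qed
  have "induced_edges E S = (\<Union>i<t. induced_edges (F i) S)"
    unfolding induced_edges_def E[symmetric] by blast
  then have "card (induced_edges E S) \<le> (\<Sum>i<t. card (induced_edges (F i) S))"
    using card_UN_le[of "{..<t}"] by simp
  also have "\<dots> < (\<Sum>i<t. 3 * card S)"
    using lt t by (intro sum_strict_mono) (auto simp: lessThan_empty_iff)
  finally show ?thesis by (simp add: algebra_simps)
qed

lemma planar_singleton: "planar {v} {}"
  unfolding planar_def plane_drawing_def by simp

lemma planar_edge:
  assumes "card e = 2"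
  shows "planar e {e}"
proof -
  obtain a b where e: "e = {a, b}" "a \<noteq> b" using assms by (auto simp: card_2_iff)
  define p where "p x = (if x = a then 0 else 1 :: complex)" for x
  have im: "p ` e = {0, 1}" unfolding e p_def using e(2) by auto
  have "plane_drawing e {e} p (\<lambda>_. linepath 0 1)"
    unfolding plane_drawing_def
  proof (intro conjI ballI impI)
    show "inj_on p e" unfolding e p_def using e(2) by (auto simp: inj_on_def)
  qed (auto simp: im)
  then show ?thesis unfolding planar_def by blast
qed

section \<open>Graphs of given thickness\<close>

lemma union_of_planar_subgraphs_exists:
  assumes "simple_graph V E"
  shows "\<exists>t. union_of_planar_subgraphs t V E"
proof -
  have V: "finite V" and E: "\<And>e. e \<in> E \<Longrightarrow> e \<subseteq> V \<and> card e = 2"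
    using assms unfolding simple_graph_def by blast+
  have "finite E" using V E by (meson Pow_iff finite_Pow_iff finite_subset subsetI)
  define P where "P = (\<lambda>v. ({v}, {})) ` V \<union> (\<lambda>e. (e, {e})) ` E"
  have "finite P" using V \<open>finite E\<close> unfolding P_def by simp
  then obtain h where h: "bij_betw h {0..<card P} P"
    using ex_bij_betw_nat_finite by blast
  then have hP: "h ` {..<card P} = P"
    unfolding bij_betw_def lessThan_atLeast0 by blast
  have fine: "fst q \<subseteq> V \<and> snd q \<subseteq> E \<and> simple_graph (fst q) (snd q) \<and> planar (fst q) (snd q)"
    if "q \<in> P" for q
  proof -
    from that consider v where "v \<in> V" "q = ({v}, {})" | e where "e \<in> E" "q = (e, {e})"
      unfolding P_def by blast
    then show ?thesis
    proof cases
      case 1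
      then show ?thesis using planar_singleton by (simp add: simple_graph_def)
    next
      case 2
      have "finite e" using E[OF 2(1)] V finite_subset by blast
      then show ?thesis using 2 E[OF 2(1)] planar_edge[of e] by (simp add: simple_graph_def)
    qed
  qed
  have in_P: "h i \<in> P" if "i < card P" for i using hP that by blast
  have "union_of_planar_subgraphs (card P) V E"
    unfolding union_of_planar_subgraphs_def
  proof (intro exI conjI allI impI)
    fix i assume "i < card P"
    note fine[OF in_P[OF this]]
    then show "fst (h i) \<subseteq> V" "snd (h i) \<subseteq> E" "simple_graph (fst (h i)) (snd (h i))"
      "planar (fst (h i)) (snd (h i))" by simp_all
  next
    have "fst ` P = (\<lambda>v. {v}) ` V \<union> E" "snd ` P = (\<lambda>v. {}) ` V \<union> (\<lambda>e. {e}) ` E"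
      unfolding P_def by (simp_all add: image_Un image_image)
    moreover have "(\<Union>i<card P. fst (h i)) = \<Union> (fst ` P)"
      using arg_cong[OF hP, of "\<lambda>A. \<Union> (fst ` A)"] by (simp add: image_image)
    moreover have "(\<Union>i<card P. snd (h i)) = \<Union> (snd ` P)"
      using arg_cong[OF hP, of "\<lambda>A. \<Union> (snd ` A)"] by (simp add: image_image)
    ultimately have "(\<Union>i<card P. fst (h i)) = V \<union> \<Union> E" "(\<Union>i<card P. snd (h i)) = E"
      by simp_all
    moreover have "\<Union> E \<subseteq> V" using E by blast
    ultimately show "(\<Union>i<card P. fst (h i)) = V" "(\<Union>i<card P. snd (h i)) = E"
      by (simp_all only: Un_absorb2)
  qed
  then show ?thesis by blast
qed

theorem theorem24:
  fixes V :: "'a set" and E :: "'a set set" and t :: nat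
  assumes "t \<ge> 1" and "simple_graph V E" and "thickness V E = t"
  shows "choosable_defect_clustering TYPE('c) V E (nat \<lceil>9 / 2 * real t\<rceil>) 1 2 \<and>
         choosable_clustering TYPE('c) V E (nat \<lceil>21 / 5 * real t\<rceil>) 9 \<and>
         choosable_clustering TYPE('c) V E (4 * t) (228 * t - 51)"
proof -
  have V: "finite V" and E: "pair_edges E" and sub: "\<And>e. e \<in> E \<Longrightarrow> e \<subseteq> V"
    using assms(2) unfolding simple_graph_def pair_edges_def by blast+
  have "union_of_planar_subgraphs t V E"
    using LeastI_ex[OF union_of_planar_subgraphs_exists[OF assms(2)]] assms(3)
    unfolding thickness_def by simp
  then have edges: "card (induced_edges E S) < 3 * t * card S" if "S \<subseteq> V" "S \<noteq> {}" for S
    using card_induced_edges_lt assms(1) V that finite_subset by blast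
  have sparse: "(r + 2) * card (induced_edges E S) < Suc r * k * card S"
    if S: "S \<subseteq> V" "S \<noteq> {}" and k: "(r + 2) * (3 * t) \<le> Suc r * k" for r k S
  proof -
    have "(r + 2) * card (induced_edges E S) < (r + 2) * (3 * t * card S)"
      by (rule mult_less_mono2[OF edges[OF S]]) simp
    also have "\<dots> = (r + 2) * (3 * t) * card S" by (simp only: mult.assoc)
    also have "\<dots> \<le> Suc r * k * card S" using k by (rule mult_le_mono1)
    finally show ?thesis .
  qed
  have clustering: "choosable_clustering TYPE('c) V E k c" if k: "4 * t \<le> k" and "3 \<le> c" for k c
    unfolding choosable_clustering_def
  proof (intro allI impI)
    fix L :: "'a \<Rightarrow> 'c set" assume L: "list_assignment V k L"
    have "(2 + 2) * card (induced_edges E S) < Suc 2 * k * card S" if "S \<subseteq> V" "S \<noteq> {}" for S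
      using k by (intro sparse[OF that]) simp
    then obtain \<phi> where \<phi>: "list_colouring V L \<phi>" "clustered E V (Suc 2) \<phi>"
      using list_colouring_clustered[OF E V L, of 2] by blast
    have "has_clustering V E \<phi> c"
      by (rule has_clustering_if_clustered[OF sub \<phi>(2)]) (use \<open>3 \<le> c\<close> in simp_all)
    then show "\<exists>\<phi>. list_colouring V L \<phi> \<and> has_clustering V E \<phi> c" using \<phi>(1) by blast
  qed
  let ?k = "nat \<lceil>9 / 2 * real t\<rceil>"
  have "choosable_defect_clustering TYPE('c) V E ?k 1 2"
    unfolding choosable_defect_clustering_def
  proof (intro allI impI)
    fix L :: "'a \<Rightarrow> 'c set" assume L: "list_assignment V ?k L"
    have "9 * t \<le> 2 * ?k" by linarith
    then have "(1 + 2) * card (induced_edges E S) < Suc 1 * ?k * card S" if "S \<subseteq> V" "S \<noteq> {}" for S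
      by (intro sparse[OF that]) simp
    then obtain \<phi> where \<phi>: "list_colouring V L \<phi>" "clustered E V (Suc 1) \<phi>"
      using list_colouring_clustered[OF E V L, of 1] by blast
    then have c2: "clustered E V 2 \<phi>" by (simp only: Suc_1)
    have "has_defect V E \<phi> 1" by (rule has_defect_if_clustered[OF E sub V c2])
    moreover have "has_clustering V E \<phi> 2"
      by (rule has_clustering_if_clustered[OF sub c2]) simp_all
    ultimately show "\<exists>\<phi>. list_colouring V L \<phi> \<and> has_defect V E \<phi> 1 \<and> has_clustering V E \<phi> 2"
      using \<phi>(1) by blast
  qed
  moreover have "choosable_clustering TYPE('c) V E (nat \<lceil>21 / 5 * real t\<rceil>) 9"
    by (rule clustering) linarith+
  moreover have "choosable_clustering TYPE('c) V E (4 * t) (228 * t - 51)"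
    using assms(1) by (intro clustering) simp_all
  ultimately show ?thesis by blast
qed

end
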